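(* Let $S$ be a non-densely defined (closed) regular symmetric operator in $\mathcal H$ with non-zero semi-deficiency indices and $\dim(\operatorname{dom}S)^\perp=\infty$. Suppose that the dual pair $\langle\widetilde S_0,\widetilde S_{*0}\rangle$ consists of closed extensions of $S_0$ in $\mathcal H_0$ such that - $\widetilde S_0$ and $-\widetilde S_{*0}$ are dissipative, - the equalities $$\operatorname{dom}\widetilde S_0\cap\operatorname{dom}\widetilde S_{*0}=\{f\in\operatorname{dom}\widetilde S_0:\operatorname{Im}(\widetilde S_0f,f)=0\}=\{g\in\operatorname{dom}\widetilde S_{*0}:\operatorname{Im}(\widetilde S_{*0}g,g)=0\}$$ hold. Then there exist maximal dissipative extensions $\widetilde S$ of $S$ in $\mathcal H$ such that $$P_{\mathcal H_0}\widetilde S\upharpoonright(\operatorname{dom}\widetilde S\cap\mathcal H_0)=\widetilde S_0,\qquad P_{\mathcal H_0}\widetilde S^*\upharpoonright(\operatorname{dom}\widetilde S^*\cap\mathcal H_0)=\widetilde S_{*0}.$$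
   Context: $\mathcal H$ is an infinite-dimensional complex separable Hilbert space; $P_{\mathfrak K}$ is the orthogonal projection onto $\mathfrak K$. $S$ is symmetric if $\operatorname{Im}(Sf,f)=0$ on $\operatorname{dom}S$; $T$ is dissipative if $\operatorname{Im}(Tf,f)\ge0$ on $\operatorname{dom}T$, and maximal dissipative if it is dissipative and has no proper dissipative extension in the same space. For a closed non-densely defined symmetric $S$: $\mathcal H_0=\overline{\operatorname{dom}}\,S$, and $S_0=P_{\mathcal H_0}S$ is a densely defined symmetric operator in $\mathcal H_0$ with domain $\operatorname{dom}S$. $S$ is regular if $S_0$ is closed. The semi-deficiency indices of $S$ are $n'_\pm=\dim\big(\mathcal H_0\ominus\operatorname{ran}(S_0\pm iI)\big)$, i.e. the deficiency indices of $S_0$ in $\mathcal H_0$. A pair $\langle\widetilde S_0,\widetilde S_{*0}\rangle$ of operators in $\mathcal H_0$ is a dual pair if $(\widetilde S_0f,g)=(f,\widetilde S_{*0}g)$ for all $f\in\operatorname{dom}\widetilde S_0$, $g\in\operatorname{dom}\widetilde S_{*0}$. *)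

theory Defs
  imports "HOL-Analysis.Analysis" "HOL-Library.Extended_Nat"
begin

text \<open>
  Complex Hilbert spaces. As in the usual convention of operator theory, \<open>cinner\<close> is linear in the
  first and conjugate-linear in the second argument. The last axiom ties it to the real inner
  product, so that \<open>cinner x x\<close> is the square of the norm of \<open>x\<close>.
\<close>

class complex_hilbert = real_inner + complete_space +
  fixes scaleC :: "complex \<Rightarrow> 'a \<Rightarrow> 'a" (infixr "*\<^sub>C" 75)
    and cinner :: "'a \<Rightarrow> 'a \<Rightarrow> complex"
  assumes scaleC_add_right: "c *\<^sub>C (x + y) = c *\<^sub>C x + c *\<^sub>C y"
    and scaleC_add_left: "(c + d) *\<^sub>C x = c *\<^sub>C x + d *\<^sub>C x"
    and scaleC_scaleC: "c *\<^sub>C d *\<^sub>C x = (c * d) *\<^sub>C x"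
    and scaleC_of_real: "complex_of_real r *\<^sub>C x = r *\<^sub>R x"
    and cinner_commute: "cinner x y = cnj (cinner y x)"
    and cinner_add_left: "cinner (x + y) z = cinner x z + cinner y z"
    and cinner_scaleC_left: "cinner (c *\<^sub>C x) y = c * cinner x y"
    and inner_eq_Re_cinner: "inner x y = Re (cinner x y)"

subclass (in complex_hilbert) banach ..

interpretation complex_hilbert: vector_space "scaleC :: complex \<Rightarrow> 'a \<Rightarrow> 'a::complex_hilbert"
proof
  show "1 *\<^sub>C x = x" for x :: 'a
    using scaleC_of_real[of 1 x] by simp
qed (simp_all add: scaleC_add_right scaleC_add_left scaleC_scaleC)

text \<open>
  The dimension of a closed complex subspace of a separable Hilbert space. The case distinction is
  needed because the library's \<open>dim\<close> is \<open>0\<close> on infinite-dimensional spaces; the only infinite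
  Hilbert dimension in a separable space is the countable one, here \<open>\<infinity>\<close>.
\<close>

definition hdim :: "'a::complex_hilbert set \<Rightarrow> enat" where
  "hdim K = (if \<exists>B. finite B \<and> K \<subseteq> complex_hilbert.span B then enat (complex_hilbert.dim K) else \<infinity>)"

definition ortho :: "'a::complex_hilbert set \<Rightarrow> 'a set" where
  "ortho K = {x. \<forall>y\<in>K. cinner x y = 0}"

text \<open>The orthogonal projection onto \<open>K\<close>, meaningful when \<open>K\<close> is a closed subspace.\<close>

definition proj :: "'a::complex_hilbert set \<Rightarrow> 'a \<Rightarrow> 'a" where
  "proj K x = (THE p. p \<in> K \<and> x - p \<in> ortho K)"

text \<open>
  Unbounded operators are represented by their graphs: \<open>(f, h) \<in> T\<close> means that \<open>f\<close> is in the domain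
  of \<open>T\<close> and \<open>T f = h\<close>. Hence \<open>Domain T\<close> is the domain of \<open>T\<close>, inclusion of graphs is extension of
  operators, and \<open>T\<close> is a closed operator iff \<open>closed T\<close> in the product topology.
\<close>

type_synonym 'a operator = "('a \<times> 'a) set"

definition operator_in :: "'a::complex_hilbert set \<Rightarrow> 'a operator \<Rightarrow> bool" where
  "operator_in K T \<longleftrightarrow> T \<subseteq> K \<times> K \<and> single_valued T \<and> (0, 0) \<in> T \<and>
     (\<forall>f h f' h'. (f, h) \<in> T \<longrightarrow> (f', h') \<in> T \<longrightarrow> (f + f', h + h') \<in> T) \<and>
     (\<forall>c f h. (f, h) \<in> T \<longrightarrow> (c *\<^sub>C f, c *\<^sub>C h) \<in> T)"

definition symmetric_op :: "'a::complex_hilbert operator \<Rightarrow> bool" where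
  "symmetric_op T \<longleftrightarrow> (\<forall>(f, h)\<in>T. Im (cinner h f) = 0)"

definition dissipative :: "'a::complex_hilbert operator \<Rightarrow> bool" where
  "dissipative T \<longleftrightarrow> (\<forall>(f, h)\<in>T. Im (cinner h f) \<ge> 0)"

definition maximal_dissipative :: "'a::complex_hilbert operator \<Rightarrow> bool" where
  "maximal_dissipative T \<longleftrightarrow> operator_in UNIV T \<and> dissipative T \<and>
     \<not> (\<exists>T'. operator_in UNIV T' \<and> dissipative T' \<and> T \<subset> T')"

definition neg_op :: "'a::complex_hilbert operator \<Rightarrow> 'a operator" where
  "neg_op T = {(f, - h) | f h. (f, h) \<in> T}"

text \<open>
  The adjoint in the whole space. For densely defined \<open>T\<close> this is the graph of the usual adjoint
  operator; maximal dissipative operators are automatically densely defined.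
\<close>

definition adj :: "'a::complex_hilbert operator \<Rightarrow> 'a operator" where
  "adj T = {(g, k). \<forall>(f, h)\<in>T. cinner h g = cinner f k}"

text \<open>The operator \<open>P\<^sub>K T\<close> restricted to \<open>dom T \<inter> K\<close>.\<close>

definition compression :: "'a::complex_hilbert set \<Rightarrow> 'a operator \<Rightarrow> 'a operator" where
  "compression K T = {(f, proj K h) | f h. (f, h) \<in> T \<and> f \<in> K}"

definition dom_closure :: "'a::complex_hilbert operator \<Rightarrow> 'a set" where
  "dom_closure S = closure (Domain S)"

definition op0 :: "'a::complex_hilbert operator \<Rightarrow> 'a operator" where
  "op0 S = {(f, proj (dom_closure S) h) | f h. (f, h) \<in> S}"

definition regular :: "'a::complex_hilbert operator \<Rightarrow> bool" where
  "regular S \<longleftrightarrow> closed (op0 S)"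

definition semi_def_index_plus :: "'a::complex_hilbert operator \<Rightarrow> enat" where
  "semi_def_index_plus S = hdim (dom_closure S \<inter> ortho {h + \<i> *\<^sub>C f | f h. (f, h) \<in> op0 S})"

definition semi_def_index_minus :: "'a::complex_hilbert operator \<Rightarrow> enat" where
  "semi_def_index_minus S = hdim (dom_closure S \<inter> ortho {h - \<i> *\<^sub>C f | f h. (f, h) \<in> op0 S})"

definition dual_pair :: "'a::complex_hilbert set \<Rightarrow> 'a operator \<Rightarrow> 'a operator \<Rightarrow> bool" where
  "dual_pair K A B \<longleftrightarrow> operator_in K A \<and> operator_in K B \<and>
     (\<forall>(f, h)\<in>A. \<forall>(g, k)\<in>B. cinner h g = cinner f k)"

end

theory Submission
  imports Defs
begin

text \<open>
  On \<open>H \<times> H\<close> consider the Hermitian form \<open>[(f,h),(f',h')] = -i ((h,f') - (f,h'))\<close>, and let \<open>J\<close> be the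
  unitary involution with \<open>[t,t'] = (J t, t')\<close>. Graphs of dissipative operators are the subspaces on
  which the form is nonnegative, the adjoint is the complement with respect to the form, and a closed
  dissipative operator is maximal as soon as the form is nonpositive on its adjoint.

  The hypotheses on the domains say that \<open>L = A \<inter> B\<close> contains all neutral vectors of \<open>A\<close> and of \<open>B\<close>, and
  \<open>H\<^sub>0 \<times> H\<^sub>0\<close> is the orthogonal sum of \<open>L\<close>, \<open>J L\<close> and a Krein space \<open>K\<close>. Let \<open>N\<close> be the orthogonal complement
  of \<open>H\<^sub>0\<close> in \<open>H\<close>. The extension \<open>T\<close> consists of the vectors with components \<open>z + F n\<close> in \<open>K\<close>, where
  \<open>J z = z\<close>, and \<open>(\<kappa> n - F\<^sup>* J z, i n)\<close> in \<open>N \<times> N\<close>. The form of such a vector is the square of the norm of \<open>z\<close> plus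
  a quadratic form in \<open>n\<close>, and the adjoint of \<open>T\<close> has the same shape with \<open>J z = - z\<close>. The compression of \<open>T\<close>
  is cut out by \<open>\<kappa> n = F\<^sup>* J z\<close>.

  As \<open>N\<close> is infinite-dimensional, it contains orthogonal copies of \<open>H \<times> H\<close>. The operator \<open>F\<close> maps two of
  them onto the parts of \<open>A\<close> and \<open>B\<close> orthogonal to \<open>L\<close> and a third one onto \<open>K\<close>; on the third copy and its
  translates under a shift \<open>V\<close> the operator \<open>\<kappa>\<close> contains the discrete Laplacian \<open>2 - V - V\<^sup>*\<close>. Hence
  \<open>\<kappa> n = F\<^sup>* J z\<close> turns the coefficients of \<open>n\<close> there into a square summable sequence with vanishing
  second differences, which is zero. What remains of the compression of \<open>T\<close> is \<open>A\<close>, and for the adjoint it is \<open>B\<close>.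

  The component of \<open>S\<close> orthogonal to \<open>H\<^sub>0\<close> is bounded in the graph norm of the closed operator \<open>S\<^sub>0\<close>. It is
  added by a shear that preserves the form.
\<close>

section \<open>Complex Hilbert spaces\<close>

lemma cinner_add_right: "cinner x (y + z) = cinner x y + cinner x (z::'a::complex_hilbert)"
  by (metis cinner_add_left cinner_commute complex_cnj_add)

lemma cinner_scaleC_right: "cinner x (c *\<^sub>C y) = cnj c * cinner x (y::'a::complex_hilbert)"
  by (metis cinner_commute cinner_scaleC_left complex_cnj_mult)

lemma cinner_zero [simp]:
  "cinner 0 (x::'a::complex_hilbert) = 0" "cinner (x::'a::complex_hilbert) 0 = 0"
  using cinner_add_left[of 0 0 x] cinner_add_right[of x 0 0] by simp_all

lemma cinner_minus:
  "cinner (- x) (y::'a::complex_hilbert) = - cinner x y" "cinner x (- y) = - cinner x (y::'a::complex_hilbert)"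
  using cinner_add_left[of x "-x" y] cinner_add_right[of x y "-y"]
  by (simp_all add: eq_neg_iff_add_eq_0 add.commute)

lemma cinner_diff_left: "cinner (x - y) z = cinner x z - cinner y (z::'a::complex_hilbert)"
  using cinner_add_left[of x "-y" z] by (simp add: cinner_minus)

lemma cinner_diff_right: "cinner x (y - z) = cinner x y - cinner x (z::'a::complex_hilbert)"
  using cinner_add_right[of x y "-z"] by (simp add: cinner_minus)

lemma scaleR_eq_scaleC: "r *\<^sub>R x = complex_of_real r *\<^sub>C (x::'a::complex_hilbert)"
  by (simp add: scaleC_of_real)

lemma cinner_scaleR:
  "cinner (r *\<^sub>R x) (y::'a::complex_hilbert) = of_real r * cinner x y"
  "cinner x (r *\<^sub>R y) = of_real r * cinner x (y::'a::complex_hilbert)"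
  by (simp_all add: scaleR_eq_scaleC cinner_scaleC_left cinner_scaleC_right)

lemmas cinner_simps = cinner_add_left cinner_add_right cinner_diff_left cinner_diff_right
  cinner_minus cinner_scaleC_left cinner_scaleC_right cinner_scaleR

lemma Re_cinner: "Re (cinner x y) = inner x (y::'a::complex_hilbert)"
  by (simp add: inner_eq_Re_cinner)

lemma Im_cinner: "Im (cinner x y) = inner x (\<i> *\<^sub>C (y::'a::complex_hilbert))"
  by (simp add: inner_eq_Re_cinner cinner_scaleC_right)

lemma cinner_eq_inner: "cinner x y = Complex (inner x y) (inner x (\<i> *\<^sub>C (y::'a::complex_hilbert)))"
  by (simp add: complex_eq_iff Re_cinner Im_cinner)

lemma cinner_self: "cinner x x = of_real ((norm (x::'a::complex_hilbert))\<^sup>2)"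
proof -
  have "Im (cinner x x) = 0"
    using cinner_commute[of x x] by (metis Reals_cnj_iff complex_is_Real_iff)
  thus ?thesis
    by (simp add: complex_eq_iff Re_cinner power2_norm_eq_inner)
qed

lemma cinner_self_eq_0 [simp]: "cinner x x = 0 \<longleftrightarrow> x = (0::'a::complex_hilbert)"
  by (simp add: cinner_self)

lemma cinner_eq_0_commute: "cinner x y = 0 \<longleftrightarrow> cinner y (x::'a::complex_hilbert) = 0"
  by (metis cinner_commute complex_cnj_zero)

lemma cinner_ext:
  assumes "\<And>z. cinner x z = cinner y (z::'a::complex_hilbert)" shows "x = y"
proof -
  have "cinner (x - y) (x - y) = 0"
    using assms by (simp add: cinner_diff_left)
  thus ?thesis by simp
qed

lemma bounded_linear_cinner_left: "bounded_linear (\<lambda>x. cinner x (y::'a::complex_hilbert))"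
proof -
  have "bounded_linear (\<lambda>x. of_real (inner x y) + \<i> * of_real (inner x (\<i> *\<^sub>C y)))"
    by (intro bounded_linear_intros bounded_linear_add bounded_linear_compose[OF bounded_linear_of_real]
        bounded_linear_compose[OF bounded_linear_mult_right])
  moreover have "(\<lambda>x. of_real (inner x y) + \<i> * of_real (inner x (\<i> *\<^sub>C y))) = (\<lambda>x. cinner x y)"
    by (auto simp: fun_eq_iff complex_eq_iff Re_cinner Im_cinner)
  ultimately show ?thesis by simp
qed

lemma bounded_linear_cinner_right: "bounded_linear (\<lambda>y. cinner (x::'a::complex_hilbert) y)"
  using bounded_linear_compose[OF bounded_linear_cnj bounded_linear_cinner_left[of x]]
  by (subst (asm) cinner_commute[symmetric])

lemma norm_scaleC: "norm (c *\<^sub>C x) = cmod c * norm (x::'a::complex_hilbert)"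
proof -
  have "cinner (c *\<^sub>C x) (c *\<^sub>C x) = (c * cnj c) * cinner x x"
    by (simp add: cinner_scaleC_left cinner_scaleC_right)
  hence "complex_of_real ((norm (c *\<^sub>C x))\<^sup>2) = of_real ((cmod c * norm x)\<^sup>2)"
    unfolding cinner_self power_mult_distrib of_real_mult complex_norm_square[symmetric] .
  thus ?thesis
    by (metis mult_nonneg_nonneg norm_ge_zero of_real_eq_iff power2_eq_imp_eq)
qed

lemma bounded_linear_scaleC: "bounded_linear (\<lambda>x::'a::complex_hilbert. c *\<^sub>C x)"
  by (rule bounded_linear_intro[where K = "cmod c"])
    (simp_all add: complex_hilbert.scale_right_distrib norm_scaleC scaleR_eq_scaleC scaleC_scaleC mult.commute)

section \<open>Products of Hilbert spaces, the home of graphs\<close>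

instantiation prod :: (complex_hilbert, complex_hilbert) complex_hilbert
begin

definition scaleC_prod :: "complex \<Rightarrow> 'a \<times> 'b \<Rightarrow> 'a \<times> 'b" where
  "scaleC_prod c x = (c *\<^sub>C fst x, c *\<^sub>C snd x)"

definition cinner_prod :: "'a \<times> 'b \<Rightarrow> 'a \<times> 'b \<Rightarrow> complex" where
  "cinner_prod x y = cinner (fst x) (fst y) + cinner (snd x) (snd y)"

instance
proof
  fix x y z :: "'a \<times> 'b" and c d :: complex and r :: real
  show "c *\<^sub>C (x + y) = c *\<^sub>C x + c *\<^sub>C y" "(c + d) *\<^sub>C x = c *\<^sub>C x + d *\<^sub>C x"
    "c *\<^sub>C d *\<^sub>C x = (c * d) *\<^sub>C x" "complex_of_real r *\<^sub>C x = r *\<^sub>R x"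
    by (simp_all add: scaleC_prod_def scaleC_add_right scaleC_add_left scaleC_scaleC scaleC_of_real
        prod_eq_iff)
  show "cinner x y = cnj (cinner y x)"
    unfolding cinner_prod_def
    by (metis cinner_commute complex_cnj_add)
  show "cinner (x + y) z = cinner x z + cinner y z" "cinner (c *\<^sub>C x) y = c * cinner x y"
    "inner x y = Re (cinner x y)"
    by (simp_all add: cinner_prod_def scaleC_prod_def cinner_simps inner_prod_def inner_eq_Re_cinner
        algebra_simps)
qed

end

lemma cinner_Pair [simp]: "cinner (a, b) (c, d) = cinner a c + cinner b d"
  by (simp add: cinner_prod_def)

lemma scaleC_Pair [simp]: "c *\<^sub>C (a, b) = (c *\<^sub>C a, c *\<^sub>C b)"
  by (simp add: scaleC_prod_def)

section \<open>Orthogonal projections\<close>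

definition closed_subspace :: "'a::complex_hilbert set \<Rightarrow> bool" where
  "closed_subspace K \<longleftrightarrow> complex_hilbert.subspace K \<and> closed K"

lemma closed_subspaceD:
  assumes "closed_subspace K"
  shows "0 \<in> K" "x \<in> K \<Longrightarrow> y \<in> K \<Longrightarrow> x + y \<in> K" "x \<in> K \<Longrightarrow> c *\<^sub>C x \<in> K" "closed K"
    "x \<in> K \<Longrightarrow> y \<in> K \<Longrightarrow> x - y \<in> K" "x \<in> K \<Longrightarrow> r *\<^sub>R x \<in> K" "x \<in> K \<Longrightarrow> - x \<in> K" "subspace K"
  using assms unfolding closed_subspace_def
  by (auto simp: complex_hilbert.subspace_0 complex_hilbert.subspace_add complex_hilbert.subspace_scale
      complex_hilbert.subspace_diff complex_hilbert.subspace_neg scaleR_eq_scaleC real_vector.subspace_def)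

lemma closed_subspace_ortho: "closed_subspace (ortho K)"
proof -
  have "ortho K = (\<Inter>y\<in>K. (\<lambda>x. cinner x y) -` {0})"
    by (auto simp: ortho_def)
  moreover have "closed ((\<lambda>x. cinner x y) -` {0})" for y :: 'a
    by (intro continuous_closed_vimage closed_singleton
        linear_continuous_at[OF bounded_linear_cinner_left])
  ultimately have "closed (ortho K)" by auto
  moreover have "complex_hilbert.subspace (ortho K)"
    by (simp add: complex_hilbert.subspace_def ortho_def cinner_simps)
  ultimately show ?thesis by (simp add: closed_subspace_def)
qed

lemma closed_subspace_Int:
  "closed_subspace K \<Longrightarrow> closed_subspace M \<Longrightarrow> closed_subspace (K \<inter> M)"
  by (auto simp: closed_subspace_def complex_hilbert.subspace_inter)

lemma closed_subspace_Times:
  "closed_subspace K \<Longrightarrow> closed_subspace M \<Longrightarrow> closed_subspace (K \<times> M)"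
  by (auto simp: closed_subspace_def complex_hilbert.subspace_def closed_Times zero_prod_def)

lemma orthoD: "x \<in> ortho K \<Longrightarrow> y \<in> K \<Longrightarrow> cinner x y = 0" "x \<in> ortho K \<Longrightarrow> y \<in> K \<Longrightarrow> cinner y x = 0"
  by (auto simp: ortho_def cinner_eq_0_commute)

text \<open>A minimizing sequence for the distance to \<open>K\<close> is Cauchy by the
  parallelogram law, and varying its limit along vectors of \<open>K\<close> gives
  orthogonality.\<close>

lemma ex_orthogonal_projection:
  fixes K :: "'a::complex_hilbert set"
  assumes K: "closed_subspace K"
  shows "\<exists>p\<in>K. x - p \<in> ortho K"
proof -
  note KD = closed_subspaceD[OF K]
  define d where "d = infdist x K"
  have ne: "K \<noteq> {}" using KD(1) by auto
  have d0: "d \<ge> 0" by (simp add: d_def infdist_nonneg)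
  have dle: "d \<le> norm (x - k)" if "k \<in> K" for k
    using infdist_le[OF that, of x] by (simp add: d_def dist_norm)
  have "\<exists>k\<in>K. norm (x - k) < d + 1 / real (Suc n)" for n
  proof -
    have "Inf (dist x ` K) < d + 1 / real (Suc n)"
      using ne by (simp add: d_def infdist_def)
    from cInf_lessD[OF _ this] ne show ?thesis
      unfolding dist_norm by blast
  qed
  then obtain k where k: "\<And>n. k n \<in> K" "\<And>n. norm (x - k n) < d + 1 / real (Suc n)"
    by metis
  have par: "(norm (u - v))\<^sup>2 = 2 * (norm (x - u))\<^sup>2 + 2 * (norm (x - v))\<^sup>2 - 4 * (norm (x - (1/2) *\<^sub>R (u + v)))\<^sup>2"
    for u v
    by (simp add: power2_norm_eq_inner inner_simps inner_commute algebra_simps)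
  have bd: "(norm (k n - k m))\<^sup>2 \<le> (8 * d + 4) * (1 / real (Suc N))" if "n \<ge> N" "m \<ge> N" for n m N
  proof -
    let ?e = "1 / real (Suc N)"
    have e: "0 \<le> ?e" "?e \<le> 1" by auto
    have "norm (x - k j) \<le> d + ?e" if "j \<ge> N" for j
      using k(2)[of j] that
      by (smt (verit) frac_le of_nat_0_less_iff of_nat_mono Suc_le_mono zero_less_Suc)
    hence "(norm (x - k n))\<^sup>2 \<le> (d + ?e)\<^sup>2" "(norm (x - k m))\<^sup>2 \<le> (d + ?e)\<^sup>2"
      using that by (auto intro!: power_mono)
    moreover have "d\<^sup>2 \<le> (norm (x - (1/2) *\<^sub>R (k n + k m)))\<^sup>2"
      by (intro power_mono dle d0 KD k)
    ultimately have "(norm (k n - k m))\<^sup>2 \<le> 4 * (d + ?e)\<^sup>2 - 4 * d\<^sup>2"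
      using par[of "k n" "k m"] by linarith
    also have "\<dots> = 8 * d * ?e + 4 * ?e * ?e"
      by (simp add: power2_eq_square algebra_simps)
    also have "\<dots> \<le> 8 * d * ?e + 4 * ?e * 1"
      using e by (intro add_left_mono mult_left_mono) auto
    finally show ?thesis by (simp only: algebra_simps)
  qed
  have "Cauchy k"
  proof (rule CauchyI)
    fix e :: real assume e: "e > 0"
    have "(\<lambda>N. (8 * d + 4) * (1 / real (Suc N))) \<longlonglongrightarrow> (8 * d + 4) * 0"
      by (intro tendsto_intros LIMSEQ_Suc[OF lim_1_over_n])
    hence "\<forall>\<^sub>F N in sequentially. (8 * d + 4) * (1 / real (Suc N)) < e\<^sup>2"
      using e by (intro order_tendstoD(2)) auto
    then obtain N where N: "(8 * d + 4) * (1 / real (Suc N)) < e\<^sup>2"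
      by (auto simp: eventually_sequentially)
    have "norm (k m - k n) < e" if "m \<ge> N" "n \<ge> N" for m n
      using le_less_trans[OF bd[OF that] N] e by (simp add: power_less_imp_less_base)
    thus "\<exists>M. \<forall>m\<ge>M. \<forall>n\<ge>M. norm (k m - k n) < e" by blast
  qed
  then obtain p where p: "k \<longlonglongrightarrow> p"
    by (auto simp: Cauchy_convergent_iff convergent_def)
  have pK: "p \<in> K"
    using closed_sequentially[OF KD(4) _ p] k(1) by auto
  have "norm (x - p) \<le> d"
  proof (rule LIMSEQ_le)
    show "(\<lambda>n. norm (x - k n)) \<longlonglongrightarrow> norm (x - p)"
      by (intro tendsto_intros p)
    have "(\<lambda>n. d + 1 / real (Suc n)) \<longlonglongrightarrow> d + 0"
      by (intro tendsto_intros LIMSEQ_Suc[OF lim_1_over_n])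
    thus "(\<lambda>n. d + 1 / real (Suc n)) \<longlonglongrightarrow> d" by simp
    show "\<exists>N. \<forall>n\<ge>N. norm (x - k n) \<le> d + 1 / real (Suc n)"
      using k(2) less_imp_le by blast
  qed
  hence pd: "norm (x - p) = d" using dle[OF pK] by simp
  have orth: "inner (x - p) y = 0" if y: "y \<in> K" for y
  proof (cases "y = 0")
    case False
    \<comment> \<open>The minimizer of the quadratic polynomial that gives the squared distance
      along the line through \<open>p\<close> in direction \<open>y\<close>.\<close>
    define t where "t = inner (x - p) y / inner y y"
    have "d \<le> norm (x - (p + t *\<^sub>R y))"
      by (intro dle KD pK y)
    hence "(norm (x - p))\<^sup>2 \<le> (norm (x - (p + t *\<^sub>R y)))\<^sup>2"
      using pd d0 by (simp add: power_mono)
    also have "\<dots> = (norm (x - p))\<^sup>2 - 2 * t * inner (x - p) y + t\<^sup>2 * inner y y"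
      unfolding power2_norm_eq_inner by (simp add: inner_simps inner_commute power2_eq_square algebra_simps)
    also have "\<dots> = (norm (x - p))\<^sup>2 - (inner (x - p) y)\<^sup>2 / inner y y"
      using False by (simp add: t_def power2_eq_square)
    finally have "(inner (x - p) y)\<^sup>2 / inner y y \<le> 0" by simp
    moreover have "0 < inner y y" using False inner_gt_zero_iff by blast
    ultimately show ?thesis
      by (smt (verit) divide_pos_pos zero_less_power2)
  qed simp
  \<comment> \<open>Real orthogonality suffices, because \<open>K\<close> contains
    \<open>\<i> *\<^sub>C y\<close> together with \<open>y\<close>.\<close>
  have "x - p \<in> ortho K"
    using orth KD(3) by (auto simp: ortho_def cinner_eq_inner complex_eq_iff)
  thus ?thesis using pK by blast
qed

lemma proj_eqI:
  assumes K: "closed_subspace K" and "p \<in> K" "x - p \<in> ortho K"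
  shows "proj K x = p"
  unfolding proj_def
proof (rule the_equality)
  show "p \<in> K \<and> x - p \<in> ortho K" using assms by simp
  fix p' assume p': "p' \<in> K \<and> x - p' \<in> ortho K"
  have "p' - p \<in> K" using assms p' closed_subspaceD by blast
  moreover have "(x - p) - (x - p') \<in> ortho K"
    using assms p' closed_subspaceD[OF closed_subspace_ortho] by blast
  ultimately have "cinner (p' - p) (p' - p) = 0"
    by (simp add: ortho_def)
  thus "p' = p" by simp
qed

lemma
  assumes K: "closed_subspace K"
  shows proj_in: "proj K x \<in> K" and proj_ortho: "x - proj K x \<in> ortho K"
  using ex_orthogonal_projection[OF K, of x] proj_eqI[OF K, of _ x] by auto

lemma proj_eq_self: "closed_subspace K \<Longrightarrow> x \<in> K \<Longrightarrow> proj K x = x"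
  by (rule proj_eqI) (auto simp: ortho_def)

lemma proj_eq_0: "closed_subspace K \<Longrightarrow> x \<in> ortho K \<Longrightarrow> proj K x = 0"
  by (rule proj_eqI) (auto dest: closed_subspaceD)

section \<open>Adjoint pairs of operators\<close>

text \<open>Carrying the adjoint along replaces separate assumptions of linearity and boundedness,
  since both follow from its existence.\<close>

definition is_adj :: "('a::complex_hilbert \<Rightarrow> 'b::complex_hilbert) \<Rightarrow> ('b \<Rightarrow> 'a) \<Rightarrow> bool" where
  "is_adj f g \<longleftrightarrow> (\<forall>x y. cinner (f x) y = cinner x (g y))"

lemma is_adjD: "is_adj f g \<Longrightarrow> cinner (f x) y = cinner x (g y)"
  by (simp add: is_adj_def)

lemma is_adj_commute: "is_adj f g \<longleftrightarrow> is_adj g f"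
  unfolding is_adj_def by (metis cinner_commute)

lemma
  assumes "is_adj f g"
  shows is_adj_add: "f (x + y) = f x + f y" and is_adj_scaleC: "f (c *\<^sub>C x) = c *\<^sub>C f x"
    and is_adj_0: "f 0 = 0" and is_adj_diff: "f (x - y) = f x - f y"
    and is_adj_scaleR: "f (r *\<^sub>R x) = r *\<^sub>R f x" and is_adj_minus: "f (- x) = - f x"
  by (rule cinner_ext, simp add: is_adjD[OF assms] cinner_simps)+

lemma is_adj_proj:
  assumes K: "closed_subspace K"
  shows "is_adj (proj K) (proj K)"
proof -
  have "cinner (proj K x) (y - proj K y) = 0" "cinner (x - proj K x) (proj K y) = 0" for x y
    using orthoD proj_in[OF K] proj_ortho[OF K] by blast+
  thus ?thesis
    by (simp add: is_adj_def cinner_simps)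
qed

lemma ortho_ortho:
  assumes K: "closed_subspace K" shows "ortho (ortho K) = K"
proof
  show "K \<subseteq> ortho (ortho K)" by (auto simp: ortho_def cinner_eq_0_commute)
  show "ortho (ortho K) \<subseteq> K"
  proof
    fix x assume x: "x \<in> ortho (ortho K)"
    have "cinner x (x - proj K x) = 0" "cinner (proj K x) (x - proj K x) = 0"
      using x proj_in[OF K, of x] proj_ortho[OF K, of x] orthoD by blast+
    hence "cinner (x - proj K x) (x - proj K x) = 0"
      by (simp add: cinner_diff_left)
    thus "x \<in> K" using proj_in[OF K, of x] by simp
  qed
qed

lemma closed_subspace_eq_UNIV:
  assumes K: "closed_subspace K" and "ortho K \<subseteq> {0}" shows "K = UNIV"
proof -
  have "UNIV \<subseteq> ortho (ortho K)" using assms(2) by (auto simp: ortho_def)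
  thus ?thesis using ortho_ortho[OF K] by blast
qed

lemma closed_subspace_closure:
  assumes K: "complex_hilbert.subspace K"
  shows "closed_subspace (closure K)"
  unfolding closed_subspace_def complex_hilbert.subspace_def
proof (intro conjI ballI allI)
  show "0 \<in> closure K"
    using K closure_subset by (auto dest: complex_hilbert.subspace_0)
  show "x + y \<in> closure K" if xy: "x \<in> closure K" "y \<in> closure K" for x y
  proof -
    obtain a b where "\<forall>n. a n \<in> K" "a \<longlonglongrightarrow> x" "\<forall>n. b n \<in> K" "b \<longlonglongrightarrow> y"
      using xy unfolding closure_sequential by blast
    thus ?thesis
      unfolding closure_sequential
      by (intro exI[of _ "\<lambda>n. a n + b n"])
        (auto intro: tendsto_add complex_hilbert.subspace_add[OF K])
  qed
  show "c *\<^sub>C x \<in> closure K" if "x \<in> closure K" for c x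
  proof -
    have "(\<lambda>x. c *\<^sub>C x) ` closure K \<subseteq> closure ((\<lambda>x. c *\<^sub>C x) ` K)"
      by (rule closure_bounded_linear_image_subset[OF bounded_linear_scaleC])
    also have "\<dots> \<subseteq> closure K"
      using K by (intro closure_mono) (auto dest: complex_hilbert.subspace_scale)
    finally show ?thesis using that by auto
  qed
qed simp

lemma ortho_closure: "ortho (closure K) = ortho K"
proof
  show "ortho (closure K) \<subseteq> ortho K"
    using closure_subset by (auto simp: ortho_def)
  show "ortho K \<subseteq> ortho (closure K)"
  proof
    fix x assume x: "x \<in> ortho K"
    have "K \<subseteq> ortho {x}" using x by (auto simp: ortho_def cinner_eq_0_commute)
    hence "closure K \<subseteq> ortho {x}"
      using closed_subspace_ortho[of "{x}"] by (intro closure_minimal) (auto dest: closed_subspaceD)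
    thus "x \<in> ortho (closure K)" by (auto simp: ortho_def cinner_eq_0_commute)
  qed
qed

text \<open>The adjoint is read off the orthogonal complement of the graph. It is densely defined, so the
  sublevel sets of the norm of \<open>f\<close> are closed, and the Baire category theorem applies to them.\<close>

lemma
  fixes f :: "'a::complex_hilbert \<Rightarrow> 'b::complex_hilbert"
  assumes add: "\<And>x y. f (x + y) = f x + f y" and scale: "\<And>c x. f (c *\<^sub>C x) = c *\<^sub>C f x"
    and clo: "closed (range (\<lambda>x. (x, f x)))"
  shows closed_graph_bounded_linear: "bounded_linear f"
    and closed_graph_adjoint: "\<exists>g. is_adj f g"
proof -
  define \<Gamma> where "\<Gamma> = range (\<lambda>x. (x, f x))"
  define D where "D = snd ` ortho \<Gamma>"
  have f0: "f 0 = 0" using scale[of 0 0] by simp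
  have fR: "f (r *\<^sub>R x) = r *\<^sub>R f x" for r x by (simp add: scaleR_eq_scaleC scale)
  have \<Gamma>: "closed_subspace \<Gamma>"
    unfolding closed_subspace_def complex_hilbert.subspace_def \<Gamma>_def
    using clo by (auto simp: zero_prod_def f0 add scale image_def)
  note O = closed_subspaceD[OF closed_subspace_ortho[of \<Gamma>]]
  have D: "complex_hilbert.subspace D"
    unfolding complex_hilbert.subspace_def D_def
  proof (intro conjI ballI allI)
    show "0 \<in> snd ` ortho \<Gamma>" using O(1) by force
    show "x + y \<in> snd ` ortho \<Gamma>" if "x \<in> snd ` ortho \<Gamma>" "y \<in> snd ` ortho \<Gamma>" for x y
      using that O(2) by (metis (no_types, lifting) image_iff snd_add)
    show "c *\<^sub>C x \<in> snd ` ortho \<Gamma>" if "x \<in> snd ` ortho \<Gamma>" for c x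
      using that O(3)[of _ c] by (auto simp: scaleC_prod_def image_iff) (metis snd_conv)
  qed
  have Dadj: "cinner (f x) y = - cinner x a" if "(a, y) \<in> ortho \<Gamma>" for x y a
    using orthoD(2)[OF that, of "(x, f x)"] by (simp add: \<Gamma>_def eq_neg_iff_add_eq_0 add.commute)
  have orthoD: "ortho D \<subseteq> {0}"
  proof
    fix z assume z: "z \<in> ortho D"
    \<comment> \<open>A vector orthogonal to \<open>D\<close> gives a point \<open>(0, z)\<close> of
      the closed graph, so it equals \<open>f 0\<close>.\<close>
    have "(0, z) \<in> ortho (ortho \<Gamma>)"
      using z by (force simp: ortho_def D_def cinner_prod_def)
    hence "(0, z) \<in> \<Gamma>" using ortho_ortho[OF \<Gamma>] by simp
    thus "z \<in> {0}" by (auto simp: \<Gamma>_def f0)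
  qed
  have clD: "closure D = UNIV"
    by (rule closed_subspace_eq_UNIV[OF closed_subspace_closure[OF D]])
      (simp add: ortho_closure orthoD)
  \<comment> \<open>As \<open>D\<close> is dense, the norm of \<open>f x\<close> can be tested on
    \<open>D\<close>, where the pairing is a continuous functional of \<open>x\<close>. Closedness
    thus needs no continuity of \<open>f\<close>.\<close>
  have lev: "{x. norm (f x) \<le> c} = (\<Inter>(a, y)\<in>ortho \<Gamma>. {x. \<bar>inner x a\<bar> \<le> c * norm y})" if "0 \<le> c" for c
  proof (intro equalityI subsetI)
    fix x assume "x \<in> {x. norm (f x) \<le> c}"
    moreover have "\<bar>inner x a\<bar> \<le> norm (f x) * norm y" if "(a, y) \<in> ortho \<Gamma>" for a y
      using arg_cong[OF Dadj[OF that, of x], of Re] Cauchy_Schwarz_ineq2[of "f x" y]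
      by (simp add: Re_cinner)
    ultimately show "x \<in> (\<Inter>(a, y)\<in>ortho \<Gamma>. {x. \<bar>inner x a\<bar> \<le> c * norm y})"
      by clarsimp (meson mult_right_mono norm_ge_zero order_trans)
  next
    fix x assume x: "x \<in> (\<Inter>(a, y)\<in>ortho \<Gamma>. {x. \<bar>inner x a\<bar> \<le> c * norm y})"
    have "D \<subseteq> {y. \<bar>inner (f x) y\<bar> \<le> c * norm y}"
    proof
      fix y assume "y \<in> D"
      then obtain a where a: "(a, y) \<in> ortho \<Gamma>" by (auto simp: D_def)
      thus "y \<in> {y. \<bar>inner (f x) y\<bar> \<le> c * norm y}"
        using x arg_cong[OF Dadj[OF a, of x], of Re] by (auto simp: Re_cinner)
    qed
    moreover have "closed {y. \<bar>inner (f x) y\<bar> \<le> c * norm y}"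
      by (intro closed_Collect_le continuous_intros)
    ultimately have "closure D \<subseteq> {y. \<bar>inner (f x) y\<bar> \<le> c * norm y}"
      by (rule closure_minimal)
    hence "\<bar>inner (f x) (f x)\<bar> \<le> c * norm (f x)"
      unfolding clD by blast
    hence "norm (f x) * norm (f x) \<le> c * norm (f x)"
      by (simp add: power2_norm_eq_inner[symmetric] power2_eq_square)
    hence "norm (f x) \<le> c \<or> f x = 0"
      by (auto simp: mult_le_cancel_right)
    thus "x \<in> {x. norm (f x) \<le> c}" using that by auto
  qed
  obtain n :: nat where "interior {x. norm (f x) \<le> real n} \<noteq> {}"
  proof (rule ccontr)
    assume "\<not> thesis"
    hence "interior {x. norm (f x) \<le> real n} = {}" for n using that by blast
    moreover have "closed {x. norm (f x) \<le> real n}" for n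
      unfolding lev[OF of_nat_0_le_iff] case_prod_unfold
      by (intro closed_INT ballI closed_Collect_le continuous_intros)
    ultimately have "euclidean interior_of (\<Union>(range (\<lambda>n. {x. norm (f x) \<le> real n}))) = {}"
      by (intro Baire_category_alt disjI1 completely_metrizable_space_euclidean) auto
    moreover have "(\<Union>n::nat. {x. norm (f x) \<le> real n}) = UNIV"
      using real_arch_simple by auto
    ultimately show False by simp
  qed
  then obtain x0 r where r: "r > 0" "ball x0 r \<subseteq> {x. norm (f x) \<le> real n}"
    by (auto simp: mem_interior)
  show bl: "bounded_linear f"
  proof (rule bounded_linear_intro)
    show "norm (f x) \<le> norm x * (4 * real n / r)" for x
    proof (cases "x = 0")
      case False
      define u where "u = (r / (2 * norm x)) *\<^sub>R x"
      have "x0 \<in> ball x0 r" "x0 + u \<in> ball x0 r"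
        using r False by (auto simp: u_def dist_norm)
      hence "norm (f (x0 + u)) \<le> real n" "norm (f x0) \<le> real n" using r(2) by blast+
      moreover have "f u = f (x0 + u) - f x0" by (simp add: add)
      ultimately have "norm (f u) \<le> 2 * real n"
        using norm_triangle_ineq4[of "f (x0 + u)" "f x0"] by simp
      thus ?thesis
        using r False by (simp add: u_def fR field_simps)
    qed (simp add: f0)
  qed (simp_all add: add fR)
  obtain B where B: "B > 0" "\<And>x. norm (f x) \<le> norm x * B"
    using bounded_linear.pos_bounded[OF bl] by blast
  \<comment> \<open>With \<open>f\<close> bounded, \<open>y\<close> controls \<open>a\<close>, so
    \<open>D\<close> is closed; being dense, it is the whole space.\<close>
  have est: "1 / (B + 1) * norm t \<le> norm (snd t)" if t: "t \<in> ortho \<Gamma>" for t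
  proof (cases t)
    case (Pair a y)
    have "inner (f a) y = - inner a a"
      using arg_cong[OF Dadj[of a y a], of Re] t Pair by (simp add: Re_cinner)
    hence "norm a * norm a \<le> norm (f a) * norm y"
      using Cauchy_Schwarz_ineq2[of "f a" y]
      by (simp add: power2_norm_eq_inner[symmetric] power2_eq_square)
    also have "\<dots> \<le> norm a * B * norm y"
      by (intro mult_right_mono B) simp
    finally have "norm a \<le> B * norm y"
      using B by (cases "a = 0") (auto simp: mult.assoc)
    moreover have "norm t \<le> norm a + norm y"
      using Pair by (simp add: norm_Pair_le)
    ultimately have "norm t \<le> (B + 1) * norm y" by (simp add: algebra_simps)
    thus ?thesis using B Pair by (simp add: field_simps)
  qed
  have "complete (snd ` ortho \<Gamma>)"
    by (rule complete_isometric_image[of "1 / (B + 1)"])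
      (use B est O in \<open>auto simp: bounded_linear_snd complete_eq_closed\<close>)
  hence "closed_subspace D"
    using D by (simp add: closed_subspace_def D_def complete_eq_closed)
  hence "D = UNIV" using orthoD by (rule closed_subspace_eq_UNIV)
  hence "\<forall>y. \<exists>a. (a, y) \<in> ortho \<Gamma>" by (force simp: D_def)
  then obtain a where "\<And>y. (a y, y) \<in> ortho \<Gamma>" by metis
  hence "is_adj f (\<lambda>y. - a y)"
    by (simp add: is_adj_def Dadj cinner_minus)
  thus "\<exists>g. is_adj f g" by blast
qed

text \<open>Hellinger-Toeplitz: the adjoint relation cuts out the graph by closed
  conditions.\<close>

lemma is_adj_bounded_linear:
  assumes "is_adj f g" shows "bounded_linear f"
proof (rule closed_graph_bounded_linear)
  have "range (\<lambda>x. (x, f x)) = (\<Inter>z. {t. cinner (snd t) z = cinner (fst t) (g z)})"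
    using assms by (auto simp: is_adj_def image_iff) (metis cinner_ext)
  moreover have "closed {t. cinner (snd t) z = cinner (fst t) (g z)}" for z
    by (intro closed_Collect_eq linear_continuous_on bounded_linear_compose[OF bounded_linear_cinner_left]
        bounded_linear_fst bounded_linear_snd)
  ultimately show "closed (range (\<lambda>x. (x, f x)))" by auto
qed (use assms in \<open>simp_all add: is_adj_add is_adj_scaleC\<close>)

section \<open>Orthonormal sequences\<close>

text \<open>Zero vectors are admitted so that the Gram--Schmidt process needs no linear independence.\<close>

definition suborthonormal :: "(nat \<Rightarrow> 'a::complex_hilbert) \<Rightarrow> bool" where
  "suborthonormal a \<longleftrightarrow> (\<forall>i j. i \<noteq> j \<longrightarrow> cinner (a i) (a j) = 0) \<and> (\<forall>i. a i = 0 \<or> norm (a i) = 1)"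

text \<open>For suborthonormal sequences, the partial isometry taking \<open>a m\<close> to
  \<open>b m\<close> wherever both are non-zero; for \<open>a = b\<close> it is the orthogonal
  projection onto the closed span.\<close>

definition transport ::
    "(nat \<Rightarrow> 'a::complex_hilbert) \<Rightarrow> (nat \<Rightarrow> 'b::complex_hilbert) \<Rightarrow> 'a \<Rightarrow> 'b" where
  "transport a b x = (\<Sum>m. cinner x (a m) *\<^sub>C b m)"

lemma norm_sum_suborthonormal:
  assumes "suborthonormal b" "finite F"
  shows "(norm (\<Sum>m\<in>F. c m *\<^sub>C b m))\<^sup>2 = (\<Sum>m\<in>F. (cmod (c m))\<^sup>2 * (norm (b m))\<^sup>2)"
  using assms
  by (subst norm_sum_Pythagorean)
    (auto simp: suborthonormal_def pairwise_def orthogonal_def inner_eq_Re_cinner cinner_simps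
      norm_scaleC power_mult_distrib)

lemma norm_sum_coefficients:
  assumes a: "suborthonormal a" and F: "finite F"
  shows "(norm (\<Sum>m\<in>F. cinner x (a m) *\<^sub>C a m))\<^sup>2 = (\<Sum>m\<in>F. (cmod (cinner x (a m)))\<^sup>2)"
  unfolding norm_sum_suborthonormal[OF a F]
proof (rule sum.cong[OF refl])
  show "(cmod (cinner x (a m)))\<^sup>2 * (norm (a m))\<^sup>2 = (cmod (cinner x (a m)))\<^sup>2" for m
    using a by (cases "a m = 0") (auto simp: suborthonormal_def)
qed

text \<open>Cauchy-Schwarz for \<open>x\<close> and the partial sum \<open>s\<close>, whose inner
  product with \<open>x\<close> is its own squared norm.\<close>

lemma Bessel_inequality:
  assumes a: "suborthonormal a" and F: "finite F"
  shows "(\<Sum>m\<in>F. (cmod (cinner x (a m)))\<^sup>2) \<le> (norm x)\<^sup>2"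
proof -
  define s where "s = (\<Sum>m\<in>F. cinner x (a m) *\<^sub>C a m)"
  have ns: "(norm s)\<^sup>2 = (\<Sum>m\<in>F. (cmod (cinner x (a m)))\<^sup>2)"
    unfolding s_def by (rule norm_sum_coefficients[OF a F])
  have "inner x s = (\<Sum>m\<in>F. Re (cinner x (cinner x (a m) *\<^sub>C a m)))"
    by (simp add: s_def inner_sum_right Re_cinner)
  also have "\<dots> = (norm s)\<^sup>2"
    unfolding ns
    by (rule sum.cong[OF refl]) (simp add: cinner_scaleC_right cmod_power2 flip: power2_eq_square)
  finally have "norm s * norm s \<le> norm x * norm s"
    using Cauchy_Schwarz_ineq2[of x s] by (simp add: power2_eq_square)
  hence "norm s \<le> norm x" by (cases "norm s = 0") auto
  thus ?thesis unfolding ns[symmetric] by (simp add: power_mono)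
qed

lemma norm_sum_transport_le:
  assumes a: "suborthonormal a" and b: "suborthonormal b" and F: "finite F"
  shows "(norm (\<Sum>m\<in>F. cinner x (a m) *\<^sub>C b m))\<^sup>2 \<le> (\<Sum>m\<in>F. (cmod (cinner x (a m)))\<^sup>2)"
  unfolding norm_sum_suborthonormal[OF b F]
proof (rule sum_mono)
  have "norm (b m) = 0 \<or> norm (b m) = 1" for m
    using b by (auto simp: suborthonormal_def)
  thus "(cmod (cinner x (a m)))\<^sup>2 * (norm (b m))\<^sup>2 \<le> (cmod (cinner x (a m)))\<^sup>2" for m
    by (metis mult.right_neutral mult_zero_right order_refl power_one zero_le_power2 zero_power2)
qed

lemma summable_coefficients:
  assumes a: "suborthonormal a"
  shows "summable (\<lambda>m. (cmod (cinner x (a m)))\<^sup>2)"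
  by (rule summableI_nonneg_bounded[where x = "(norm x)\<^sup>2"]) (auto intro: Bessel_inequality[OF a])

lemma coefficients_tendsto_0:
  assumes a: "suborthonormal a"
  shows "(\<lambda>m. cinner x (a m)) \<longlonglongrightarrow> 0"
proof -
  have "(\<lambda>m. sqrt ((cmod (cinner x (a m)))\<^sup>2)) \<longlonglongrightarrow> sqrt 0"
    by (intro tendsto_real_sqrt summable_LIMSEQ_zero summable_coefficients a)
  thus ?thesis by (simp add: tendsto_norm_zero_iff)
qed

lemma summable_transport:
  assumes a: "suborthonormal a" and b: "suborthonormal b"
  shows "summable (\<lambda>m. cinner x (a m) *\<^sub>C b m)"
  unfolding summable_Cauchy
proof (intro allI impI)
  fix e :: real assume e: "e > 0"
  then obtain N where N: "\<And>m n. m \<ge> N \<Longrightarrow> norm (\<Sum>k\<in>{m..<n}. (cmod (cinner x (a k)))\<^sup>2) < e\<^sup>2"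
    using summable_coefficients[OF a, of x] unfolding summable_Cauchy
    by (meson zero_less_power)
  have "norm (\<Sum>k\<in>{m..<n}. cinner x (a k) *\<^sub>C b k) < e" if "m \<ge> N" for m n
  proof -
    have "(norm (\<Sum>k\<in>{m..<n}. cinner x (a k) *\<^sub>C b k))\<^sup>2 < e\<^sup>2"
      using norm_sum_transport_le[OF a b, of "{m..<n}" x] N[OF that, of n]
      by (smt (verit) finite_atLeastLessThan real_norm_def sum_nonneg zero_le_power2)
    thus ?thesis using e by (simp add: power_less_imp_less_base)
  qed
  thus "\<exists>N. \<forall>m\<ge>N. \<forall>n. norm (\<Sum>k\<in>{m..<n}. cinner x (a k) *\<^sub>C b k) < e" by blast
qed

lemma is_adj_transport:
  assumes a: "suborthonormal a" and b: "suborthonormal b"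
  shows "is_adj (transport a b) (transport b a)"
  unfolding is_adj_def transport_def
    bounded_linear.suminf[OF bounded_linear_cinner_left summable_transport[OF a b]]
    bounded_linear.suminf[OF bounded_linear_cinner_right summable_transport[OF b a]]
  by (simp add: cinner_simps flip: cinner_commute) (simp add: mult.commute)

lemma norm_transport_le:
  assumes a: "suborthonormal a" and b: "suborthonormal b"
  shows "norm (transport a b x) \<le> norm x"
proof (rule LIMSEQ_le_const2)
  show "(\<lambda>n. norm (\<Sum>m<n. cinner x (a m) *\<^sub>C b m)) \<longlonglongrightarrow> norm (transport a b x)"
    unfolding transport_def
    by (intro tendsto_norm summable_LIMSEQ summable_transport a b)
  show "\<exists>N. \<forall>n\<ge>N. norm (\<Sum>m<n. cinner x (a m) *\<^sub>C b m) \<le> norm x"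
    using order_trans[OF norm_sum_transport_le[OF a b] Bessel_inequality[OF a]]
    by (meson finite_lessThan norm_ge_zero power2_le_imp_le)
qed

lemma transport_basis:
  assumes a: "suborthonormal a"
  shows "transport a b (a m) = complex_of_real ((norm (a m))\<^sup>2) *\<^sub>C b m"
proof -
  have "(\<lambda>k. cinner (a m) (a k) *\<^sub>C b k) = (\<lambda>k. if k = m then complex_of_real ((norm (a m))\<^sup>2) *\<^sub>C b k else 0)"
    using a by (auto simp: fun_eq_iff suborthonormal_def cinner_self)
  thus ?thesis
    unfolding transport_def using sums_single[of m "\<lambda>k. complex_of_real ((norm (a m))\<^sup>2) *\<^sub>C b k"]
    by (simp add: sums_iff)
qed

lemma transport_eq_0: "(\<And>m. cinner x (a m) = 0) \<Longrightarrow> transport a b x = 0"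
  by (simp add: transport_def)

text \<open>Since \<open>sgn 0 = 0\<close>, a linearly dependent entry turns into a zero
  vector.\<close>

fun gram_schmidt :: "(nat \<Rightarrow> 'a::complex_hilbert) \<Rightarrow> nat \<Rightarrow> 'a" where
  "gram_schmidt x n = sgn (x n - (\<Sum>j<n. cinner (x n) (gram_schmidt x j) *\<^sub>C gram_schmidt x j))"

declare gram_schmidt.simps [simp del]

lemma cinner_sum_left: "cinner (\<Sum>i\<in>F. f i) y = (\<Sum>i\<in>F. cinner (f i) (y::'a::complex_hilbert))"
  by (induction F rule: infinite_finite_induct) (simp_all add: cinner_add_left)

lemma gram_schmidt_norm: "gram_schmidt x n = 0 \<or> norm (gram_schmidt x n) = 1"
  by (subst (1 2) gram_schmidt.simps) (simp add: norm_sgn sgn_zero_iff)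

lemma gram_schmidt_orthogonal: "i < n \<Longrightarrow> cinner (gram_schmidt x n) (gram_schmidt x i) = 0"
proof (induction n arbitrary: i rule: less_induct)
  case (less n)
  let ?g = "gram_schmidt x"
  have *: "cinner (?g j) (?g i) = 0" if "j < n" "j \<noteq> i" for j
    using less.IH[of j i] less.IH[of i j] less.prems that cinner_eq_0_commute
    by (metis linorder_neqE_nat)
  have "(\<Sum>j<n. cinner (x n) (?g j) * cinner (?g j) (?g i))
      = (\<Sum>j<n. if j = i then cinner (x n) (?g i) * cinner (?g i) (?g i) else 0)"
    by (rule sum.cong) (auto simp: *)
  also have "\<dots> = cinner (x n) (?g i)"
    using less.prems gram_schmidt_norm[of x i] by (auto simp: cinner_self)
  finally have "cinner (x n - (\<Sum>j<n. cinner (x n) (?g j) *\<^sub>C ?g j)) (?g i) = 0"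
    by (simp add: cinner_diff_left cinner_sum_left cinner_scaleC_left)
  thus ?case
    by (subst gram_schmidt.simps) (simp add: sgn_div_norm cinner_scaleR)
qed

lemma suborthonormal_gram_schmidt: "suborthonormal (gram_schmidt x)"
  unfolding suborthonormal_def
  using gram_schmidt_norm gram_schmidt_orthogonal cinner_eq_0_commute
  by (metis linorder_neqE_nat)

text \<open>\<open>x n\<close> is a combination of the Gram-Schmidt vectors up to index
  \<open>n\<close>, each of which is fixed.\<close>

lemma transport_gram_schmidt: "transport (gram_schmidt x) (gram_schmidt x) (x n) = x n"
proof -
  let ?g = "gram_schmidt x" let ?R = "transport ?g ?g"
  note adj = is_adj_transport[OF suborthonormal_gram_schmidt suborthonormal_gram_schmidt, of x x]
  define r where "r = x n - (\<Sum>j<n. cinner (x n) (?g j) *\<^sub>C ?g j)"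
  have lin: "linear ?R" using is_adj_bounded_linear[OF adj] by (rule bounded_linear.linear)
  have g: "?R (?g j) = ?g j" for j
    using gram_schmidt_norm[of x j] by (auto simp: transport_basis[OF suborthonormal_gram_schmidt])
  have "?g n = sgn r" unfolding r_def by (rule gram_schmidt.simps)
  hence "r = norm r *\<^sub>R ?g n" by (cases "r = 0") (simp_all add: sgn_div_norm)
  hence xn: "x n = norm r *\<^sub>R ?g n + (\<Sum>j<n. cinner (x n) (?g j) *\<^sub>C ?g j)"
    by (simp add: r_def algebra_simps)
  have "?R (x n) = norm r *\<^sub>R ?g n + (\<Sum>j<n. cinner (x n) (?g j) *\<^sub>C ?g j)"
    using arg_cong[OF xn, of ?R]
    by (simp add: is_adj_add[OF adj] is_adj_scaleR[OF adj] is_adj_scaleC[OF adj] g linear_sum[OF lin])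
  thus ?thesis using xn by simp
qed

lemma ex_complete_suborthonormal:
  assumes "countable D" "closure D = (UNIV :: 'a::complex_hilbert set)"
  shows "\<exists>d :: nat \<Rightarrow> 'a. suborthonormal d \<and> (\<forall>x. transport d d x = x)"
proof -
  define d where "d = gram_schmidt (from_nat_into D)"
  have d: "suborthonormal d" by (simp add: d_def suborthonormal_gram_schmidt)
  have "D \<noteq> {}" using assms by auto
  hence "D = range (from_nat_into D)" using assms by simp
  hence "D \<subseteq> {x. transport d d x = x}"
    using transport_gram_schmidt[of "from_nat_into D"] unfolding d_def by (metis (mono_tags, lifting) mem_Collect_eq rangeE subsetI)
  moreover have "closed {x. transport d d x = x}"
    by (intro closed_Collect_eq continuous_on_id linear_continuous_on
        is_adj_bounded_linear[OF is_adj_transport[OF d d]])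
  ultimately have "closure D \<subseteq> {x. transport d d x = x}"
    by (rule closure_minimal)
  thus ?thesis using d assms by auto
qed

text \<open>Gram-Schmidt by dependent choice: a finite span never contains \<open>N\<close>, so a
  vector outside it is always available and no zero vector arises.\<close>

lemma ex_orthonormal_sequence:
  fixes N :: "'a::complex_hilbert set"
  assumes N: "complex_hilbert.subspace N" and inf: "hdim N = \<infinity>"
  shows "\<exists>e. suborthonormal e \<and> (\<forall>m. e m \<in> N \<and> norm (e m) = 1)"
proof -
  define P where "P = (\<lambda>e (m::nat) v. v \<in> N \<and> norm v = 1 \<and> (\<forall>j<m. cinner v (e j :: 'a) = 0))"
  have "\<exists>e. \<forall>m::nat. P e m (e m)"
  proof (rule dependent_wellorder_choice)
    show "P f m v = P g m v" if "\<And>y. y < m \<Longrightarrow> f y = g y" for v f g m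
      using that by (simp add: P_def)
    fix m and e :: "nat \<Rightarrow> 'a"
    assume e: "\<And>y. y < m \<Longrightarrow> P e y (e y)"
    have "\<not> N \<subseteq> complex_hilbert.span (e ` {..<m})"
      using inf unfolding hdim_def by (metis enat.distinct(2) finite_imageI finite_lessThan)
    then obtain x where x: "x \<in> N" "x \<notin> complex_hilbert.span (e ` {..<m})" by blast
    define s where "s = (\<Sum>j<m. cinner x (e j) *\<^sub>C e j)"
    have "s \<in> N"
      using e unfolding s_def P_def
      by (intro complex_hilbert.subspace_sum[OF N] complex_hilbert.subspace_scale[OF N]) blast
    moreover have "s \<in> complex_hilbert.span (e ` {..<m})"
      unfolding s_def
      by (intro complex_hilbert.span_sum complex_hilbert.span_scale) (auto intro: complex_hilbert.span_base)
    ultimately have s: "s \<in> N" "s \<in> complex_hilbert.span (e ` {..<m})" by blast+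
    have ne: "x - s \<noteq> 0" using x s by auto
    have orth: "cinner (x - s) (e i) = 0" if "i < m" for i
    proof -
      have *: "cinner (e j) (e i) = 0" if "j < m" "j \<noteq> i" for j
        using e[of j] e[of i] \<open>i < m\<close> that cinner_eq_0_commute unfolding P_def
        by (metis linorder_neqE_nat)
      have "(\<Sum>j<m. cinner x (e j) * cinner (e j) (e i))
          = (\<Sum>j<m. if j = i then cinner x (e i) * cinner (e i) (e i) else 0)"
        by (rule sum.cong) (auto simp: *)
      also have "\<dots> = cinner x (e i)"
        using \<open>i < m\<close> e[of i] by (auto simp: cinner_self P_def)
      finally show ?thesis
        by (simp add: s_def cinner_diff_left cinner_sum_left cinner_scaleC_left)
    qed
    have "P e m (sgn (x - s))"
      unfolding P_def
    proof (intro conjI allI impI)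
      show "sgn (x - s) \<in> N"
        using x s unfolding sgn_div_norm scaleR_eq_scaleC
        by (intro complex_hilbert.subspace_scale[OF N] complex_hilbert.subspace_diff[OF N])
      show "norm (sgn (x - s)) = 1" using ne by (simp add: norm_sgn)
      show "cinner (sgn (x - s)) (e j) = 0" if "j < m" for j
        using orth[OF that] by (simp add: sgn_div_norm cinner_scaleR)
    qed
    thus "\<exists>v. P e m v" by blast
  qed
  then obtain e where e: "\<And>m. P e m (e m)" by blast
  hence "cinner (e i) (e j) = 0" if "i \<noteq> j" for i j
    using that cinner_eq_0_commute unfolding P_def by (metis linorder_neqE_nat)
  thus ?thesis using e by (intro exI[of _ e]) (auto simp: suborthonormal_def P_def)
qed

section \<open>The indefinite form and maximal dissipative operators\<close>

definition bounded_clinear :: "('a::complex_hilbert \<Rightarrow> 'b::complex_hilbert) \<Rightarrow> bool" where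
  "bounded_clinear f \<longleftrightarrow> bounded_linear f \<and> (\<forall>c x. f (c *\<^sub>C x) = c *\<^sub>C f x)"

lemma is_adj_bounded_clinear: "is_adj f g \<Longrightarrow> bounded_clinear f"
  by (simp add: bounded_clinear_def is_adj_bounded_linear is_adj_scaleC)

lemma bounded_clinear_compose:
  "bounded_clinear f \<Longrightarrow> bounded_clinear g \<Longrightarrow> bounded_clinear (\<lambda>x. f (g x))"
  by (simp add: bounded_clinear_def bounded_linear_compose)

lemma bounded_clinear_add:
  "bounded_clinear f \<Longrightarrow> bounded_clinear g \<Longrightarrow> bounded_clinear (\<lambda>x. f x + g x)"
  by (simp add: bounded_clinear_def bounded_linear_add scaleC_add_right)

lemma bounded_clinear_diff:
  "bounded_clinear f \<Longrightarrow> bounded_clinear g \<Longrightarrow> bounded_clinear (\<lambda>x. f x - g x)"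
  by (simp add: bounded_clinear_def bounded_linear_sub complex_hilbert.scale_right_diff_distrib)

lemma bounded_clinear_scaleC: "bounded_clinear f \<Longrightarrow> bounded_clinear (\<lambda>x. c *\<^sub>C f x)"
  by (simp add: bounded_clinear_def bounded_linear_compose[OF bounded_linear_scaleC] scaleC_scaleC mult.commute)

lemma bounded_clinear_Pair:
  "bounded_clinear f \<Longrightarrow> bounded_clinear g \<Longrightarrow> bounded_clinear (\<lambda>x. (f x, g x))"
  by (simp add: bounded_clinear_def bounded_linear_Pair)

lemma bounded_clinear_fst: "bounded_clinear fst"
  and bounded_clinear_snd: "bounded_clinear snd"
  by (simp_all add: bounded_clinear_def bounded_linear_fst bounded_linear_snd scaleC_prod_def)

lemma closed_subspace_kernel:
  assumes "bounded_clinear f" shows "closed_subspace {x. f x = 0}"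
proof -
  have f: "bounded_linear f" "\<And>c x. f (c *\<^sub>C x) = c *\<^sub>C f x"
    using assms by (auto simp: bounded_clinear_def)
  then interpret bounded_linear f by simp
  show ?thesis
    unfolding closed_subspace_def complex_hilbert.subspace_def
    using f by (auto simp: zero add intro!: closed_Collect_eq linear_continuous_on)
qed

text \<open>The indefinite form \<open>cinner (J t) t'\<close> takes the value \<open>2 Im (T f, f)\<close> on the diagonal of the
  graph of \<open>T\<close>, and the adjoint of \<open>T\<close> is the orthogonal complement of \<open>T\<close> with respect to it.\<close>

definition J :: "'a::complex_hilbert \<times> 'a \<Rightarrow> 'a \<times> 'a" where
  "J t = (- (\<i> *\<^sub>C snd t), \<i> *\<^sub>C fst t)"

lemma cinner_J: "cinner (J t) u = - \<i> * (cinner (snd t) (fst u) - cinner (fst t) (snd u))"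
  by (simp add: J_def cinner_prod_def cinner_simps algebra_simps)

lemma is_adj_J: "is_adj J J"
  by (simp add: is_adj_def J_def cinner_prod_def cinner_simps algebra_simps)

lemma J_J [simp]: "J (J t) = t"
  by (simp add: J_def prod_eq_iff scaleC_scaleC)

lemma cinner_J_self: "cinner (J t) t = of_real (2 * Im (cinner (snd t) (fst t)))"
proof -
  have "cinner (fst t) (snd t) = cnj (cinner (snd t) (fst t))" by (rule cinner_commute)
  thus ?thesis unfolding cinner_J by (simp add: complex_eq_iff)
qed

lemma adj_eq_form_complement: "adj T = {u. \<forall>t\<in>T. cinner (J t) u = 0}"
  by (auto simp: adj_def cinner_J)

lemma dissipative_eq: "dissipative T \<longleftrightarrow> (\<forall>t\<in>T. 0 \<le> Re (cinner (J t) t))"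
  by (auto simp: dissipative_def cinner_J_self)

text \<open>The map \<open>?s\<close> is \<open>T + \<i>\<close>. It is bounded below on every
  dissipative graph and onto already on \<open>T\<close>, which leaves no room for an
  extension.\<close>

lemma maximal_dissipativeI:
  fixes T :: "'a::complex_hilbert operator"
  assumes T: "operator_in UNIV T" "closed T" and diss: "dissipative T"
    and adj: "\<And>t. t \<in> adj T \<Longrightarrow> Re (cinner (J t) t) \<le> 0"
  shows "maximal_dissipative T"
proof -
  let ?s = "\<lambda>t::'a\<times>'a. snd t + \<i> *\<^sub>C fst t"
  have cs: "closed_subspace T"
    using T by (auto simp: closed_subspace_def complex_hilbert.subspace_def operator_in_def zero_prod_def)
  have nrm: "(norm t)\<^sup>2 \<le> (norm (?s t))\<^sup>2" if "Re (cinner (J t) t) \<ge> 0" for t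
  proof -
    have "complex_of_real ((norm (?s t))\<^sup>2) = cinner t t + cinner (J t) t"
      unfolding cinner_self[symmetric] cinner_J
      by (simp add: cinner_prod_def cinner_simps algebra_simps)
    hence "(norm (?s t))\<^sup>2 = Re (cinner t t + cinner (J t) t)"
      by (metis Re_complex_of_real)
    thus ?thesis using that by (simp add: cinner_self)
  qed
  have bl: "bounded_clinear ?s"
    by (intro bounded_clinear_add bounded_clinear_scaleC bounded_clinear_fst bounded_clinear_snd)
  have "complete (?s ` T)"
  proof (rule complete_isometric_image[of 1])
    show "\<forall>t\<in>T. 1 * norm t \<le> norm (?s t)"
      using nrm diss by (auto simp: dissipative_eq intro: power2_le_imp_le)
  qed (use cs bl in \<open>auto simp: bounded_clinear_def complete_eq_closed dest: closed_subspaceD\<close>)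
  hence "closed_subspace (?s ` T)"
    unfolding closed_subspace_def complex_hilbert.subspace_def complete_eq_closed
  proof (intro conjI ballI allI)
    have add: "?s (t + u) = ?s t + ?s u" and scale: "?s (c *\<^sub>C t) = c *\<^sub>C ?s t" for t u c
      by (simp_all add: scaleC_prod_def scaleC_add_right scaleC_scaleC mult.commute algebra_simps)
    show "0 \<in> ?s ` T" using closed_subspaceD(1)[OF cs] by (force simp: zero_prod_def)
    show "x + y \<in> ?s ` T" if "x \<in> ?s ` T" "y \<in> ?s ` T" for x y
      using that closed_subspaceD(2)[OF cs] add by (metis (no_types, lifting) image_iff)
    show "c *\<^sub>C x \<in> ?s ` T" if "x \<in> ?s ` T" for c x
      using that closed_subspaceD(3)[OF cs] scale by (metis (no_types, lifting) image_iff)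
  qed
  moreover have "ortho (?s ` T) \<subseteq> {0}"
  proof
    fix g assume g: "g \<in> ortho (?s ` T)"
    \<comment> \<open>A vector orthogonal to the range is an eigenvector of the adjoint for
      \<open>\<i>\<close>, on which the form is twice the squared norm.\<close>
    have "(g, \<i> *\<^sub>C g) \<in> adj T"
    proof -
      have "cinner (?s t) g = 0" if "t \<in> T" for t
        using orthoD(2)[OF g] that by blast
      thus ?thesis by (simp add: adj_eq_form_complement cinner_J cinner_simps eq_neg_iff_add_eq_0)
    qed
    from adj[OF this] have "(norm g)\<^sup>2 \<le> 0"
      by (simp add: cinner_J_self cinner_scaleC_left cinner_self)
    thus "g \<in> {0}" by simp
  qed
  ultimately have onto: "?s ` T = UNIV" by (rule closed_subspace_eq_UNIV)
  have "T' \<subseteq> T" if T': "operator_in UNIV T'" "dissipative T'" "T \<subseteq> T'" for T'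
  proof
    fix t assume t: "t \<in> T'"
    have "?s t \<in> ?s ` T" unfolding onto by simp
    then obtain u where u: "?s t = ?s u" "u \<in> T" by (rule imageE)
    have "complex_hilbert.subspace T'"
      using T'(1) by (auto simp: complex_hilbert.subspace_def operator_in_def zero_prod_def)
    hence "t - u \<in> T'"
      using t u T'(3) by (intro complex_hilbert.subspace_diff) auto
    hence "(norm (t - u))\<^sup>2 \<le> (norm (?s (t - u)))\<^sup>2"
      using T'(2) by (intro nrm) (auto simp: dissipative_eq)
    also have "?s (t - u) = 0"
      using u(1) by (simp add: complex_hilbert.scale_right_diff_distrib algebra_simps)
    finally show "t \<in> T" using u by simp
  qed
  thus ?thesis
    using T diss by (auto simp: maximal_dissipative_def)
qed

section \<open>The coupled extension\<close>

text \<open>Three isometries with orthogonal ranges inside \<open>N\<close>, and the shift \<open>V\<close> on a sequence of copies of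
  the range of \<open>U2\<close>. The condition \<open>chain\<close> is the fact that a square summable solution of
  \<open>2 c\<^sub>k = c\<^sub>k\<^sub>-\<^sub>1 + c\<^sub>k\<^sub>+\<^sub>1\<close> vanishes.\<close>

locale chain_isometries =
  fixes N :: "'a::complex_hilbert set"
    and U0 U1 U2 :: "'b::complex_hilbert \<Rightarrow> 'a" and U0s U1s U2s :: "'a \<Rightarrow> 'b"
    and V Vs :: "'a \<Rightarrow> 'a"
  assumes U0: "is_adj U0 U0s" "\<And>x. U0s (U0 x) = x" "\<And>x. U0 x \<in> N"
    and U1: "is_adj U1 U1s" "\<And>x. U1s (U1 x) = x" "\<And>x. U1 x \<in> N"
    and U2: "is_adj U2 U2s" "\<And>x. U2s (U2 x) = x" "\<And>x. U2 x \<in> N"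
    and U_orth: "\<And>x. U0s (U1 x) = 0" "\<And>x. U0s (U2 x) = 0" "\<And>x. U1s (U0 x) = 0"
      "\<And>x. U1s (U2 x) = 0" "\<And>x. U2s (U0 x) = 0" "\<And>x. U2s (U1 x) = 0"
    and V: "is_adj V Vs" "\<And>n. norm (V n) \<le> norm n" "\<And>n. V n \<in> N" "\<And>n. Vs n \<in> N"
    and VU: "\<And>x. V (U0 x) = 0" "\<And>x. V (U1 x) = 0" "\<And>x. Vs (U0 x) = 0" "\<And>x. Vs (U1 x) = 0"
    and chain: "\<And>n u x y. 2 *\<^sub>R n - V n - Vs n = U2 u + U0 x + U1 y \<Longrightarrow>
      V n = 0 \<and> Vs n = 0 \<and> U2s n = 0"

text \<open>\<open>A_neutral\<close> and \<open>B_neutral\<close> express the domain equalities.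
  \<open>G\<close> will be \<open>- \<i>\<close> times the component of \<open>S\<close> orthogonal
  to \<open>H0\<close>, and the condition on \<open>Gs\<close> says that it lives on
  \<open>A \<inter> B\<close>.\<close>

locale coupling = chain_isometries "ortho H0" U0 U1 U2 U0s U1s U2s V Vs
  for H0 :: "'a::complex_hilbert set"
    and U0 U1 U2 :: "'a \<times> 'a \<Rightarrow> 'a" and U0s U1s U2s :: "'a \<Rightarrow> 'a \<times> 'a"
    and V Vs :: "'a \<Rightarrow> 'a" +
  fixes A B :: "('a \<times> 'a) set" and G :: "'a \<times> 'a \<Rightarrow> 'a" and Gs :: "'a \<Rightarrow> 'a \<times> 'a"
  assumes H0: "closed_subspace H0"
    and A: "closed_subspace A" "A \<subseteq> H0 \<times> H0" and B: "closed_subspace B" "B \<subseteq> H0 \<times> H0"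
    and dual: "\<And>a b. a \<in> A \<Longrightarrow> b \<in> B \<Longrightarrow> cinner (J a) b = 0"
    and A_nonneg: "\<And>a. a \<in> A \<Longrightarrow> 0 \<le> Re (cinner (J a) a)"
    and B_nonpos: "\<And>b. b \<in> B \<Longrightarrow> Re (cinner (J b) b) \<le> 0"
    and A_neutral: "\<And>a. a \<in> A \<Longrightarrow> cinner (J a) a = 0 \<Longrightarrow> a \<in> B"
    and B_neutral: "\<And>b. b \<in> B \<Longrightarrow> cinner (J b) b = 0 \<Longrightarrow> b \<in> A"
    and G: "is_adj G Gs" "\<And>x. G x \<in> ortho H0" "\<And>y. Gs y \<in> A \<inter> B"
begin

definition "L = A \<inter> B"
text \<open>The Krein space \<open>K\<close> of the overview, with \<open>J\<close> as its
  fundamental symmetry.\<close>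

definition "K1 = (H0 \<times> H0) \<inter> ortho L \<inter> ortho (J ` L)"
definition "PL = proj L"
definition "P1 = proj K1"
definition "p = proj (A \<inter> ortho L)"
definition "q = proj (B \<inter> ortho L)"

text \<open>The operators \<open>kappa_plus\<close> and \<open>kappa_minus\<close> play the role of \<open>\<kappa>\<close> for the extension and for its
  adjoint. Beyond the positive part \<open>kappa0\<close>, their summands are forced by the identity \<open>duality\<close> below and
  by the requirement that \<open>U0 a\<close>, for \<open>a \<in> A\<close> orthogonal to \<open>L\<close>, is in the kernel of \<open>kappa_plus\<close>, and
  likewise for \<open>U1\<close>, \<open>B\<close> and \<open>kappa_minus\<close>.\<close>

definition "av n = p (U0s n)"
definition "bv n = q (U1s n)"
definition "vv n = P1 (U2s n)"
definition "F n = av n + bv n + vv n"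
definition "Fs x = U0 (p x) + U1 (q x) + U2 (P1 x)"
definition "kappa0 n = 2 *\<^sub>R (n - U0 (av n) - U1 (bv n)) - V n - Vs n"
definition "kappa_plus n = kappa0 n - (1/2) *\<^sub>R U2 (J (vv n)) - U0 (p (J (vv n))) - U1 (q (J (vv n))) - U1 (q (J (bv n)))"
definition "kappa_minus n = - kappa0 n - (1/2) *\<^sub>R U2 (J (vv n)) - U0 (p (J (vv n))) - U1 (q (J (vv n))) - U0 (p (J (av n)))"

section \<open>Decomposition of \<open>H0 \<times> H0\<close> into \<open>L\<close>,
  \<open>J L\<close> and \<open>K1\<close>\<close>

lemma cs_L: "closed_subspace L" and cs_K1: "closed_subspace K1"
  and cs_A: "closed_subspace (A \<inter> ortho L)" and cs_B: "closed_subspace (B \<inter> ortho L)"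
  unfolding L_def K1_def
  by (intro closed_subspace_Int closed_subspace_Times closed_subspace_ortho A B H0)+

lemmas adjs = is_adj_J G(1) U0(1) U1(1) U2(1) V(1)
  is_adj_proj[OF cs_L, folded PL_def] is_adj_proj[OF cs_K1, folded P1_def]
  is_adj_proj[OF cs_A, folded p_def] is_adj_proj[OF cs_B, folded q_def]

lemmas adjs' = adjs adjs[THEN is_adj_commute[THEN iffD1]]

lemmas lin = adjs'[THEN is_adj_add] adjs'[THEN is_adj_diff] adjs'[THEN is_adj_minus]
  adjs'[THEN is_adj_0] adjs'[THEN is_adj_scaleR]

lemma A_L: "x \<in> A \<Longrightarrow> l \<in> L \<Longrightarrow> cinner (J x) l = 0" "x \<in> A \<Longrightarrow> l \<in> L \<Longrightarrow> cinner (J l) x = 0"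
  and B_L: "x \<in> B \<Longrightarrow> l \<in> L \<Longrightarrow> cinner (J x) l = 0" "x \<in> B \<Longrightarrow> l \<in> L \<Longrightarrow> cinner (J l) x = 0"
  using dual is_adjD[OF is_adj_J] cinner_eq_0_commute unfolding L_def by (metis IntD1 IntD2)+

lemma L_H0: "L \<subseteq> H0 \<times> H0"
  using A by (auto simp: L_def)

lemma J_H0: "x \<in> H0 \<times> H0 \<Longrightarrow> J x \<in> H0 \<times> H0"
  using closed_subspaceD[OF H0] by (auto simp: J_def)

lemma ortho_JL: "x \<in> ortho (J ` L) \<longleftrightarrow> J x \<in> ortho L"
  by (auto simp: ortho_def is_adjD[OF is_adj_J])

lemma L_neutral: "J l \<in> ortho L" if "l \<in> L"
  using that A_L(1) by (auto simp: ortho_def L_def)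

lemma A'_K1: "A \<inter> ortho L \<subseteq> K1"
  using A A_L(1) by (auto simp: K1_def ortho_JL) (auto simp: ortho_def)

lemma B'_K1: "B \<inter> ortho L \<subseteq> K1"
  using B B_L(1) by (auto simp: K1_def ortho_JL) (auto simp: ortho_def)

lemma J_K1: "x \<in> K1 \<Longrightarrow> J x \<in> K1"
  using J_H0[of x] by (simp add: K1_def ortho_JL)

lemma L_ortho_K1: "l \<in> L \<Longrightarrow> l \<in> ortho K1" "l \<in> L \<Longrightarrow> J l \<in> ortho K1"
  by (auto simp: K1_def ortho_def cinner_eq_0_commute)

lemma P1_0: "l \<in> L \<Longrightarrow> P1 l = 0" "l \<in> L \<Longrightarrow> P1 (J l) = 0"
  unfolding P1_def using proj_eq_0[OF cs_K1] L_ortho_K1 by auto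

lemma PL_0: "x \<in> K1 \<Longrightarrow> PL x = 0" "l \<in> L \<Longrightarrow> PL (J l) = 0"
  unfolding PL_def using proj_eq_0[OF cs_L] L_neutral by (auto simp: K1_def)

lemma ranges: "PL x \<in> L" "P1 x \<in> K1" "p x \<in> A" "q x \<in> B" "p x \<in> K1" "q x \<in> K1" "p x \<in> ortho L" "q x \<in> ortho L"
  using proj_in[OF cs_L, of x] proj_in[OF cs_K1, of x] proj_in[OF cs_A, of x] proj_in[OF cs_B, of x]
    A'_K1 B'_K1
  by (auto simp: PL_def P1_def p_def q_def)

lemma idem: "l \<in> L \<Longrightarrow> PL l = l" "k \<in> K1 \<Longrightarrow> P1 k = k" "x \<in> A \<Longrightarrow> x \<in> ortho L \<Longrightarrow> p x = x"
   "x \<in> B \<Longrightarrow> x \<in> ortho L \<Longrightarrow> q x = x"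
  by (simp_all add: PL_def P1_def p_def q_def proj_eq_self cs_L cs_K1 cs_A cs_B)

lemma K1_closed: "x \<in> K1 \<Longrightarrow> y \<in> K1 \<Longrightarrow> x + y \<in> K1" "x \<in> K1 \<Longrightarrow> y \<in> K1 \<Longrightarrow> x - y \<in> K1"
    "x \<in> K1 \<Longrightarrow> r *\<^sub>R x \<in> K1"
  using closed_subspaceD[OF cs_K1] by blast+

lemma F_K1: "F n \<in> K1" "vv n \<in> K1" "av n \<in> K1" "bv n \<in> K1"
  by (auto simp: F_def av_def bv_def vv_def intro!: K1_closed ranges)

text \<open>\<open>L\<close> and \<open>J L\<close> are orthogonal because \<open>L\<close> is
  neutral, so both projections can be subtracted independently, and the rest lies in
  \<open>K1\<close>.\<close>

lemma decomposition:
  assumes x: "x \<in> H0 \<times> H0"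
  shows "x = PL x + P1 x + J (PL (J x))"
proof -
  note cH = closed_subspaceD[OF closed_subspace_Times[OF H0 H0]]
  let ?k = "x - PL x - J (PL (J x))"
  have o: "x - PL x \<in> ortho L" "J x - PL (J x) \<in> ortho L"
    unfolding PL_def by (rule proj_ortho[OF cs_L])+
  have "?k \<in> H0 \<times> H0"
    by (intro cH x J_H0) (use ranges(1) L_H0 in blast)+
  moreover have "?k \<in> ortho L"
    using closed_subspaceD(5)[OF closed_subspace_ortho o(1) L_neutral[OF ranges(1)]] .
  moreover have "J ?k \<in> ortho L"
    using closed_subspaceD(5)[OF closed_subspace_ortho o(2) L_neutral[OF ranges(1)], of x]
    by (simp add: lin algebra_simps)
  ultimately have "?k \<in> K1" by (simp add: K1_def ortho_JL)
  moreover have "x - ?k \<in> ortho K1"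
    using closed_subspaceD(2)[OF closed_subspace_ortho L_ortho_K1(1)[OF ranges(1)] L_ortho_K1(2)[OF ranges(1)], of x "J x"]
    by (simp add: add.commute)
  ultimately have "P1 x = ?k"
    unfolding P1_def by (intro proj_eqI cs_K1)
  thus ?thesis by (simp add: algebra_simps)
qed

text \<open>The adjoint of \<open>G\<close> has its range in \<open>L\<close>, so \<open>G\<close>
  vanishes on the complement of \<open>L\<close>.\<close>

lemma G_PL: "G x = G (PL x)"
proof (rule cinner_ext)
  fix y
  have "PL (Gs y) = Gs y" using G(3) by (intro idem) (simp add: L_def)
  thus "cinner (G x) y = cinner (G (PL x)) y"
    by (metis G(1) adjs(7) is_adjD)
qed

lemma Gs_L: "Gs y \<in> L"
  using G(3) by (simp add: L_def)

section \<open>The operators on the complement of \<open>H0\<close> and their forms\<close>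

lemma is_adj_F: "is_adj F Fs"
  by (simp add: is_adj_def F_def Fs_def av_def bv_def vv_def cinner_simps
      adjs'[THEN is_adjD])

lemma AB_dual: "cinner (J (av n)) (bv m) = 0" "cinner (J (bv n)) (av m) = 0"
  using dual[of "av n" "bv m"] dual[of "av m" "bv n"] ranges is_adjD[OF is_adj_J] cinner_eq_0_commute
  unfolding av_def bv_def by metis+

lemma cinner_U:
  "cinner (U0 (p x)) m = cinner x (av m)" "cinner n (U0 (p x)) = cinner (av n) x"
  "cinner (U1 (q x)) m = cinner x (bv m)" "cinner n (U1 (q x)) = cinner (bv n) x"
  "cinner (U2 (P1 x)) m = cinner x (vv m)" "cinner n (U2 (P1 x)) = cinner (vv n) x"
  by (simp_all add: av_def bv_def vv_def adjs'[THEN is_adjD])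

lemma cinner_U2:
  assumes "x \<in> K1"
  shows "cinner (U2 x) m = cinner x (vv m)" "cinner n (U2 x) = cinner (vv n) x"
  using cinner_U(5,6)[where x = x] idem(2)[OF assms] by auto

lemma kappa0_selfadj: "cinner (kappa0 n) m = cinner n (kappa0 m)"
proof -
  have "cinner (V n) m = cinner n (Vs m)" "cinner (Vs n) m = cinner n (V m)"
    using V(1) is_adj_commute is_adjD by metis+
  moreover have "av n = p (av n)" "bv n = q (bv n)" for n
    using ranges[of "U0s n"] ranges[of "U1s n"] by (auto simp: av_def bv_def idem)
  hence "cinner (U0 (av n)) m = cinner (av n) (av m)" "cinner (U1 (bv n)) m = cinner (bv n) (bv m)"
    "cinner n (U0 (av m)) = cinner (av n) (av m)" "cinner n (U1 (bv m)) = cinner (bv n) (bv m)"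
    by (metis cinner_U)+
  ultimately show ?thesis
    by (simp add: kappa0_def cinner_simps algebra_simps)
qed

text \<open>The self-adjoint \<open>kappa0\<close> cancels. Of the terms of \<open>J F n\<close>
  against \<open>F m\<close>, the mixed ones of \<open>av\<close> and \<open>bv\<close> vanish, and
  the others are shared out between the two operators, half of the \<open>vv\<close> term to
  each.\<close>

lemma duality: "cinner (kappa_plus n) m + cinner n (kappa_minus m) + cinner (J (F n)) (F m) = 0"
proof -
  have 1: "cinner (kappa_plus n) m = cinner (kappa0 n) m - (1/2) * cinner (J (vv n)) (vv m) - cinner (J (vv n)) (av m)
      - cinner (J (vv n)) (bv m) - cinner (J (bv n)) (bv m)"
    by (simp add: kappa_plus_def cinner_simps cinner_U cinner_U2 J_K1 F_K1)
  have 2: "cinner n (kappa_minus m) = - cinner (kappa0 n) m - (1/2) * cinner (J (vv n)) (vv m) - cinner (J (av n)) (vv m)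
      - cinner (J (bv n)) (vv m) - cinner (J (av n)) (av m)"
    by (simp add: kappa_minus_def cinner_simps cinner_U cinner_U2 J_K1 F_K1 kappa0_selfadj is_adjD[OF is_adj_J])
  show ?thesis
    unfolding 1 2 F_def lin cinner_simps AB_dual by (simp add: algebra_simps)
qed

text \<open>On the part \<open>m\<close> left after removing the components \<open>U0 (av n)\<close>
  and \<open>U1 (bv n)\<close>, this is the positivity of \<open>2 - V - Vs\<close> for a
  contraction \<open>V\<close>.\<close>

lemma kappa0_nonneg: "0 \<le> Re (cinner (kappa0 n) n)"
proof -
  define m where "m = n - U0 (av n) - U1 (bv n)"
  have pav: "av n = p (av n)" "bv n = q (bv n)"
    using ranges[of "U0s n"] ranges[of "U1s n"] by (auto simp: av_def bv_def idem)
  have c: "cinner (U0 (av n)) x = cinner (av n) (av x)" "cinner (U1 (bv n)) x = cinner (bv n) (bv x)" for x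
    using cinner_U(1)[where x = "av n"] cinner_U(3)[where x = "bv n"] pav by simp_all
  have "av (U0 (av n)) = av n" "bv (U1 (bv n)) = bv n" "av (U1 (bv n)) = 0" "bv (U0 (av n)) = 0"
    using pav by (simp_all add: av_def bv_def U0 U1 U_orth lin)
  hence m0: "av m = 0" "bv m = 0"
    by (simp_all add: m_def) (simp_all add: av_def bv_def lin)
  have nm: "n = m + U0 (av n) + U1 (bv n)" by (simp add: m_def)
  have Vn: "V n = V m" by (subst nm) (simp add: lin VU)
  have Vsn: "Vs n = Vs m" by (subst nm) (simp add: lin VU)
  have "cinner (V m) (U0 x) = 0" "cinner (V m) (U1 x) = 0" "cinner (Vs m) (U0 x) = 0" "cinner (Vs m) (U1 x) = 0" for x
    by (simp_all add: adjs'[THEN is_adjD] VU is_adjD[OF is_adj_commute[THEN iffD1, OF V(1)]])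
  hence "cinner (V n) n = cinner (V m) m" "cinner (Vs n) n = cinner (Vs m) m"
    unfolding Vn Vsn by (subst nm, simp add: cinner_simps)+
  moreover have "cinner m n = cinner m m"
    using c[of m] m0 by (subst nm) (simp add: cinner_simps cinner_eq_0_commute)
  ultimately have "cinner (kappa0 n) n = 2 * cinner m m - cinner (V m) m - cinner (Vs m) m"
    by (simp add: kappa0_def cinner_simps flip: m_def)
  moreover have "cinner (Vs m) m = cnj (cinner (V m) m)"
    by (metis V(1) cinner_commute is_adjD)
  ultimately have "Re (cinner (kappa0 n) n) = 2 * (norm m * norm m - inner (V m) m)"
    by (simp add: cinner_self Re_cinner power2_eq_square)
  moreover have "inner (V m) m \<le> norm m * norm m"
    using norm_cauchy_schwarz[of "V m" m] mult_right_mono[OF V(2)[of m] norm_ge_zero[of m]] by linarith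
  ultimately show ?thesis by simp
qed

text \<open>The equation that cuts out the compression, for the extension
  (\<open>\<sigma> = 1\<close>) and its adjoint (\<open>\<sigma> = - 1\<close>) at once. Solving it
  for \<open>kappa0 n\<close> brings it into the form of \<open>chain\<close>.\<close>

lemma kernel_trivial:
  assumes z: "z \<in> K1" "J z = \<sigma> *\<^sub>R z" and \<sigma>: "\<sigma> = 1 \<or> \<sigma> = - 1"
    and eq: "(if \<sigma> = 1 then kappa_plus n else kappa_minus n) = Fs (J z)"
  shows "z = 0 \<and> vv n = 0 \<and> (\<sigma> = 1 \<longrightarrow> bv n = 0 \<and> n = U0 (av n)) \<and>
    (\<sigma> = -1 \<longrightarrow> av n = 0 \<and> n = U1 (bv n))"
proof -
  have pav: "av n = p (av n)" "bv n = q (bv n)"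
    using ranges[of "U0s n"] ranges[of "U1s n"] by (auto simp: av_def bv_def idem)
  have Jz: "P1 (J z) = J z"
    by (intro idem J_K1 z)
  have "\<sigma> *\<^sub>R kappa0 n = (if \<sigma> = 1 then kappa_plus n else kappa_minus n) + (1/2) *\<^sub>R U2 (J (vv n)) + U0 (p (J (vv n))) + U1 (q (J (vv n)))
      + (if \<sigma> = 1 then U1 (q (J (bv n))) else U0 (p (J (av n))))"
    using \<sigma> by (auto simp: kappa_plus_def kappa_minus_def)
  hence kappa0: "\<sigma> *\<^sub>R kappa0 n = U2 (J z + (1/2) *\<^sub>R J (vv n)) + U0 (p (J z + J (vv n))) + U1 (q (J z + J (vv n)))
      + (if \<sigma> = 1 then U1 (q (J (bv n))) else U0 (p (J (av n))))"
    unfolding eq Fs_def Jz by (simp add: lin)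
  have "\<sigma> *\<^sub>R \<sigma> *\<^sub>R kappa0 n = kappa0 n" using \<sigma> by auto
  hence "2 *\<^sub>R n - V n - Vs n = 2 *\<^sub>R U0 (av n) + 2 *\<^sub>R U1 (bv n) + \<sigma> *\<^sub>R (\<sigma> *\<^sub>R kappa0 n)"
    by (simp add: kappa0_def algebra_simps)
  also have "\<dots> = U2 (\<sigma> *\<^sub>R (J z + (1/2) *\<^sub>R J (vv n)))
     + U0 (2 *\<^sub>R av n + \<sigma> *\<^sub>R (p (J z + J (vv n)) + (if \<sigma> = 1 then 0 else p (J (av n)))))
     + U1 (2 *\<^sub>R bv n + \<sigma> *\<^sub>R (q (J z + J (vv n)) + (if \<sigma> = 1 then q (J (bv n)) else 0)))"
    unfolding kappa0 by (simp add: lin algebra_simps)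
  finally have V0: "V n = 0" "Vs n = 0" "U2s n = 0"
    using chain by blast+
  hence v0: "vv n = 0" by (simp add: vv_def lin)
  have e: "2 *\<^sub>R (n - U0 (av n) - U1 (bv n)) = \<sigma> *\<^sub>R (U2 (J z) + U0 (p (J z)) + U1 (q (J z))
      + (if \<sigma> = 1 then U1 (q (J (bv n))) else U0 (p (J (av n)))))"
  proof -
    have "2 *\<^sub>R (n - U0 (av n) - U1 (bv n)) = \<sigma> *\<^sub>R (\<sigma> *\<^sub>R kappa0 n)"
      using \<sigma> by (auto simp: kappa0_def V0)
    thus ?thesis unfolding kappa0 v0 by (simp add: lin)
  qed
  \<comment> \<open>\<open>U2s\<close> annihilates \<open>n\<close> and the ranges of
    \<open>U0\<close> and \<open>U1\<close>, so only the copy of \<open>J z\<close>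
    survives.\<close>
  have "0 = \<sigma> *\<^sub>R J z"
    using arg_cong[OF e, of U2s] \<sigma> by (auto simp: lin V0 U_orth U2)
  hence "J z = 0" using \<sigma> by auto
  hence z0: "z = 0" by (metis J_J lin(1) is_adj_0[OF is_adj_J])
  have e': "2 *\<^sub>R (n - U0 (av n) - U1 (bv n)) = \<sigma> *\<^sub>R (if \<sigma> = 1 then U1 (q (J (bv n))) else U0 (p (J (av n))))"
    using e unfolding z0 by (simp add: lin)
  have pn: "p (U0s n) = av n" "q (U1s n) = bv n" by (simp_all add: av_def bv_def)
  have "bv n = 0 \<and> n = U0 (av n)" if s: "\<sigma> = 1"
  proof -
    \<comment> \<open>The left side of \<open>e'\<close> vanishes under \<open>q\<close> after
      \<open>U1s\<close>. This makes \<open>bv n\<close> neutral, hence a vector of \<open>L\<close>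
      that is orthogonal to \<open>L\<close>.\<close>
    have "0 = q (U1s (U1 (q (J (bv n)))))"
      using arg_cong[OF e', of "\<lambda>x. q (U1s x)"] s pav by (simp add: lin U_orth U1 pn)
    hence "q (J (bv n)) = 0" using ranges idem by (metis U1(2))
    hence "cinner (J (bv n)) (bv n) = 0"
      by (metis adjs(10) cinner_zero(1) is_adjD pav(2))
    hence "bv n \<in> L" using B_neutral[of "bv n"] ranges by (auto simp: L_def bv_def)
    moreover have "bv n \<in> ortho L" using ranges by (simp add: bv_def)
    ultimately have b0: "bv n = 0" using orthoD(1) cinner_self_eq_0 by blast
    thus ?thesis using e' s by (simp add: lin)
  qed
  moreover have "av n = 0 \<and> n = U1 (bv n)" if s: "\<sigma> = -1"
  proof -
    have "0 = p (U0s (U0 (p (J (av n)))))"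
      using arg_cong[OF e', of "\<lambda>x. p (U0s x)"] s pav by (simp add: lin U_orth U0 pn)
    hence "p (J (av n)) = 0" using ranges idem by (metis U0(2))
    hence "cinner (J (av n)) (av n) = 0"
      by (metis adjs(9) cinner_zero(1) is_adjD pav(1))
    hence "av n \<in> L" using A_neutral[of "av n"] ranges by (auto simp: L_def av_def)
    moreover have "av n \<in> ortho L" using ranges by (simp add: av_def)
    ultimately have b0: "av n = 0" using orthoD(1) cinner_self_eq_0 by blast
    thus ?thesis using e' s by (simp add: lin)
  qed
  ultimately show ?thesis using z0 v0 by blast
qed

section \<open>Coordinates and the subspaces \<open>W\<close>\<close>

text \<open>The factor \<open>- \<i>\<close> in \<open>n2\<close> makes the form on the complement of \<open>H0\<close> hyperbolic:
  it becomes \<open>cinner (n1 t) (n2 u) + cinner (n2 t) (n1 u)\<close>.\<close>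

definition "xc t = (proj H0 (fst t), proj H0 (snd t))"
definition "n1 t = fst t - proj H0 (fst t)"
definition "n2 t = - (\<i> *\<^sub>C (snd t - proj H0 (snd t)))"
definition "nn t = n2 t - G (xc t)"
definition "zz t = P1 (xc t) - F (nn t)"
definition "mk x a b = x + (a, \<i> *\<^sub>C b)" for x :: "'a \<times> 'a"
text \<open>\<open>W 1 kappa_plus\<close> is the extension and \<open>W (-1) kappa_minus\<close> its
  adjoint. The shear adds \<open>G\<close> of the \<open>L\<close> component to \<open>n2\<close>
  and \<open>- J (Gs (n1 t))\<close> to the \<open>J L\<close> component; their contributions to the
  form cancel.\<close>

definition "W \<sigma> \<kappa> = {t. J (zz t) = \<sigma> *\<^sub>R zz t \<and> PL (J (xc t)) = - Gs (n1 t) \<and>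
  n1 t = \<kappa> (nn t) - Fs (J (zz t))}"

lemma xc_H0: "xc t \<in> H0 \<times> H0"
  by (simp add: xc_def proj_in H0)

lemmas ND = closed_subspaceD[OF closed_subspace_ortho[of H0]]

lemma n_N: "n1 t \<in> ortho H0" "n2 t \<in> ortho H0" "nn t \<in> ortho H0"
proof -
  show "n1 t \<in> ortho H0" "n2 t \<in> ortho H0"
    unfolding n1_def n2_def by (intro ND(3,7) proj_ortho H0)+
  thus "nn t \<in> ortho H0"
    by (auto simp: nn_def intro!: ND G)
qed

lemma mk_coords: "mk (xc t) (n1 t) (n2 t) = t"
  by (simp add: mk_def xc_def n1_def n2_def prod_eq_iff scaleC_scaleC
      flip: complex_hilbert.scale_minus_right)

lemma
  assumes "x \<in> H0 \<times> H0" "a \<in> ortho H0" "b \<in> ortho H0"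
  shows xc_mk: "xc (mk x a b) = x" and n1_mk: "n1 (mk x a b) = a" and n2_mk: "n2 (mk x a b) = b"
proof -
  have "proj H0 (fst x + a) = fst x" "proj H0 (snd x + \<i> *\<^sub>C b) = snd x"
    using assms by (auto intro!: proj_eqI[OF H0] simp: ND(3))
  thus "xc (mk x a b) = x" "n1 (mk x a b) = a" "n2 (mk x a b) = b"
    by (simp_all add: xc_def n1_def n2_def mk_def scaleC_scaleC flip: complex_hilbert.scale_minus_right)
qed

lemma cinner_J_mk:
  assumes x: "x \<in> H0 \<times> H0" "y \<in> H0 \<times> H0" and n: "a \<in> ortho H0" "b \<in> ortho H0" "c \<in> ortho H0" "d \<in> ortho H0"
  shows "cinner (J (mk x a b)) (mk y c d) = cinner (J x) y + cinner a d + cinner b c"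
proof -
  have "cinner (fst x) c = 0" "cinner (snd x) d = 0" "cinner (fst x) d = 0" "cinner (snd x) c = 0"
    "cinner a (snd y) = 0" "cinner b (fst y) = 0" "cinner a (fst y) = 0" "cinner b (snd y) = 0"
    using x by (auto simp: orthoD[OF n(1)] orthoD[OF n(2)] orthoD[OF n(3)] orthoD[OF n(4)])
  thus ?thesis
    by (simp add: cinner_J mk_def cinner_simps algebra_simps)
qed

text \<open>Only \<open>t\<close> is constrained, so an arbitrary candidate \<open>u\<close> for the
  adjoint can be tested.\<close>

lemma half_pair:
  assumes t: "PL (J (xc t)) = - Gs (n1 t)"
  shows "cinner (J t) u = cinner (PL (xc t)) (J (xc u) + Gs (n1 u)) + cinner (J (P1 (xc t))) (xc u)
    + cinner (n1 t) (nn u) + cinner (nn t) (n1 u)"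
proof -
  have "J (xc t) = J (PL (xc t)) + J (P1 (xc t)) - Gs (n1 t)"
    by (subst decomposition[OF xc_H0[of t]]) (simp add: lin t)
  hence 1: "cinner (J (xc t)) (xc u)
      = cinner (PL (xc t)) (J (xc u)) + cinner (J (P1 (xc t))) (xc u) - cinner (n1 t) (G (xc u))"
    by (simp add: cinner_simps is_adjD[OF is_adj_J] is_adjD[OF is_adj_commute[THEN iffD1, OF G(1)]])
  have 2: "cinner (G (xc t)) (n1 u) = cinner (PL (xc t)) (Gs (n1 u))"
    by (subst G_PL) (rule is_adjD[OF G(1)])
  have "cinner (J t) u = cinner (J (xc t)) (xc u) + cinner (n1 t) (n2 u) + cinner (n2 t) (n1 u)"
    using cinner_J_mk[OF xc_H0[of t] xc_H0[of u] n_N(1,2)[of t] n_N(1,2)[of u]]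
    unfolding mk_coords .
  thus ?thesis
    unfolding 1 nn_def using 2 by (simp add: cinner_simps)
qed

lemma cinner_P1: "x \<in> K1 \<Longrightarrow> cinner x (P1 y) = cinner x y"
  using is_adjD[OF adjs(8), of x y] idem(2) by simp

text \<open>The terms with \<open>Fs\<close> in \<open>n1\<close> cancel the mixed terms of
  \<open>zz\<close> and \<open>F\<close>.\<close>

lemma W_pair:
  assumes t: "t \<in> W \<sigma> \<kappa>" and u: "u \<in> W \<sigma>' \<kappa>'"
  shows "cinner (J t) u = cinner (J (zz t)) (zz u) + cinner (J (F (nn t))) (F (nn u))
    + cinner (\<kappa> (nn t)) (nn u) + cinner (nn t) (\<kappa>' (nn u))"
proof -
  have "PL (J (xc u) + Gs (n1 u)) = 0"
    using u idem(1)[OF Gs_L] by (simp add: W_def lin)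
  hence 1: "cinner (PL (xc t)) (J (xc u) + Gs (n1 u)) = 0"
    by (metis adjs(7) cinner_zero(2) idem(1) is_adjD ranges(1))
  have P: "P1 (xc t) = zz t + F (nn t)" "P1 (xc u) = zz u + F (nn u)" by (simp_all add: zz_def)
  have 2: "cinner (J (P1 (xc t))) (xc u) = cinner (J (zz t + F (nn t))) (zz u + F (nn u))"
    unfolding P[symmetric] by (rule cinner_P1[symmetric, OF J_K1[OF ranges(2)]])
  have n: "n1 t = \<kappa> (nn t) - Fs (J (zz t))" "n1 u = \<kappa>' (nn u) - Fs (J (zz u))"
    "PL (J (xc t)) = - Gs (n1 t)"
    using t u by (auto simp: W_def)
  have 3: "cinner (Fs x) m = cinner x (F m)" "cinner m (Fs x) = cinner (F m) x" for x m
    using is_adj_F is_adj_commute is_adjD by metis+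
  have "cinner (J t) u = cinner (J (zz t + F (nn t))) (zz u + F (nn u))
      + cinner (n1 t) (nn u) + cinner (nn t) (n1 u)"
    unfolding half_pair[OF n(3), of u] 1 2 by simp
  thus ?thesis
    unfolding n(1,2) by (simp add: lin cinner_simps 3 is_adjD[OF is_adj_J])
qed

lemma zz_K1: "zz t \<in> K1"
  unfolding zz_def by (intro K1_closed ranges F_K1)

lemma W_orthogonal:
  assumes t: "t \<in> W 1 kappa_plus" and u: "u \<in> W (-1) kappa_minus"
  shows "cinner (J t) u = 0"
proof -
  have "cinner (J (zz t)) (zz u) = cinner (zz t) (zz u)" "cinner (zz t) (J (zz u)) = - cinner (zz t) (zz u)"
    using t u by (simp_all add: W_def cinner_minus)
  hence "cinner (J (zz t)) (zz u) = 0"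
    using is_adjD[OF is_adj_J, of "zz t" "zz u"] by (simp add: eq_neg_iff_add_eq_0)
  thus ?thesis
    unfolding W_pair[OF t u] using duality[of "nn t" "nn u"] by (simp add: algebra_simps)
qed

text \<open>All terms with \<open>vv n\<close> cancel. What remains is twice the form of
  \<open>kappa0\<close>, plus the form on \<open>A\<close>, minus the form on
  \<open>B\<close>.\<close>

lemma kappa_plus_form: "0 \<le> Re (2 * cinner (kappa_plus n) n + cinner (J (F n)) (F n))"
proof -
  have 1: "cinner (kappa_plus n) n = cinner (kappa0 n) n - (1/2) * cinner (J (vv n)) (vv n) - cinner (J (vv n)) (av n)
      - cinner (J (vv n)) (bv n) - cinner (J (bv n)) (bv n)"
    by (simp add: kappa_plus_def cinner_simps cinner_U cinner_U2 J_K1 F_K1)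
  have c: "Re (cinner (J x) y) = Re (cinner (J y) x)" for x y :: "'a \<times> 'a"
    using is_adjD[OF is_adj_J, of x y] cinner_commute[of x "J y"] by simp
  have "Re (2 * cinner (kappa_plus n) n + cinner (J (F n)) (F n))
      = 2 * Re (cinner (kappa0 n) n) + Re (cinner (J (av n)) (av n)) - Re (cinner (J (bv n)) (bv n))"
    unfolding 1 F_def lin cinner_simps AB_dual
    using c[of "vv n" "av n"] c[of "vv n" "bv n"] by simp
  moreover have "0 \<le> Re (cinner (J (av n)) (av n))" "Re (cinner (J (bv n)) (bv n)) \<le> 0"
    using A_nonneg B_nonpos ranges by (auto simp: av_def bv_def)
  ultimately show ?thesis using kappa0_nonneg[of n] by linarith
qed

lemma Re_cinner_commute: "Re (cinner x y) = Re (cinner y (x::'b::complex_hilbert))"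
  by (metis cinner_commute complex_cnj(1) complex.sel(1) complex_surj cnj.sel(1))

lemma W_nonneg:
  assumes t: "t \<in> W 1 kappa_plus" shows "0 \<le> Re (cinner (J t) t)"
proof -
  have "cinner (J (zz t)) (zz t) = cinner (zz t) (zz t)" using t by (simp add: W_def)
  thus ?thesis
    unfolding W_pair[OF t t] using kappa_plus_form[of "nn t"] Re_cinner_commute[of "kappa_plus (nn t)" "nn t"]
    by (simp add: cinner_self, insert zero_le_power2[of "norm (zz t)"], linarith)
qed

text \<open>By \<open>duality\<close>, the quadratic form belonging to \<open>kappa_minus\<close> is
  the negative of the one in \<open>kappa_plus_form\<close>.\<close>

lemma W_nonpos:
  assumes t: "t \<in> W (-1) kappa_minus" shows "Re (cinner (J t) t) \<le> 0"
proof -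
  have "cinner (J (zz t)) (zz t) = - cinner (zz t) (zz t)" using t by (simp add: W_def cinner_minus)
  thus ?thesis
    unfolding W_pair[OF t t] using kappa_plus_form[of "nn t"] Re_cinner_commute[of "kappa_minus (nn t)" "nn t"]
      arg_cong[OF duality[of "nn t" "nn t"], of Re]
    by (simp add: cinner_self, insert zero_le_power2[of "norm (zz t)"], linarith)
qed

lemma kappa_plus_N: "n \<in> ortho H0 \<Longrightarrow> kappa_plus n \<in> ortho H0" and kappa_minus_N: "n \<in> ortho H0 \<Longrightarrow> kappa_minus n \<in> ortho H0"
  and Fs_N: "Fs x \<in> ortho H0"
  unfolding kappa_plus_def kappa_minus_def kappa0_def Fs_def by (intro ND U0 U1 U2 V | assumption)+

text \<open>Supplies test vectors: \<open>s\<close>, \<open>z\<close> and \<open>n\<close> can be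
  chosen independently.\<close>

lemma W_parametrization:
  assumes s: "s \<in> L" and z: "z \<in> K1" "J z = \<sigma> *\<^sub>R z" and n: "n \<in> ortho H0"
    and a: "a = \<kappa> n - Fs (J z)" "\<kappa> n \<in> ortho H0"
  defines "t \<equiv> mk (s + (z + F n) - J (Gs a)) a (n + G s)"
  shows "t \<in> W \<sigma> \<kappa>" "xc t = s + (z + F n) - J (Gs a)" "n1 t = a" "nn t = n" "zz t = z"
    "P1 (xc t) = z + F n" "PL (xc t) = s"
proof -
  note cH = closed_subspaceD[OF closed_subspace_Times[OF H0 H0]]
  have zF: "z + F n \<in> K1" by (intro K1_closed z F_K1)
  have zH: "z + F n \<in> H0 \<times> H0" using zF by (simp only: K1_def Int_iff)
  have inH: "s + (z + F n) - J (Gs a) \<in> H0 \<times> H0"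
    by (intro cH(5)[OF cH(2)[OF _ zH]] J_H0) (use s L_H0 Gs_L in blast)+
  have aN: "a \<in> ortho H0" unfolding a(1) by (intro ND a Fs_N)
  have bN: "n + G s \<in> ortho H0" by (intro ND n G)
  note mk = xc_mk[OF inH aN bN] n1_mk[OF inH aN bN] n2_mk[OF inH aN bN]
  show xc: "xc t = s + (z + F n) - J (Gs a)" and n1: "n1 t = a" using mk by (simp_all add: t_def)
  show P1: "P1 (xc t) = z + F n"
    unfolding xc using P1_0 s Gs_L idem(2)[OF zF] by (simp add: lin)
  show PL: "PL (xc t) = s"
    unfolding xc using PL_0(1)[OF zF] PL_0(2)[OF Gs_L] idem(1)[OF s] by (simp add: lin)
  show nn: "nn t = n"
    using mk(3) G_PL[of "xc t"] by (simp add: nn_def PL) (simp add: t_def)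
  show zz: "zz t = z" by (simp add: zz_def P1 nn)
  have "PL (J (xc t)) = - Gs a"
    unfolding xc using PL_0(1)[OF J_K1[OF zF]] PL_0(2)[OF s] idem(1)[OF Gs_L] by (simp add: lin)
  thus "t \<in> W \<sigma> \<kappa>"
    by (simp add: W_def zz nn n1 z a(1))
qed

section \<open>The adjoint and the closedness of the extension\<close>

lemma is_adj_kp: "is_adj kappa_plus (\<lambda>m. - kappa_minus m - Fs (J (F m)))"
proof -
  have "cinner (kappa_plus n) m = cinner n (- kappa_minus m - Fs (J (F m)))" for n m
    using duality[of n m] is_adjD[OF is_adj_F, of n "J (F m)"]
    by (simp add: cinner_simps is_adjD[OF is_adj_J] eq_neg_iff_add_eq_0 algebra_simps)
  thus ?thesis by (simp add: is_adj_def)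
qed

lemma adj_W: "adj (W 1 kappa_plus) = W (-1) kappa_minus"
proof
  show "W (-1) kappa_minus \<subseteq> adj (W 1 kappa_plus)"
    using W_orthogonal by (auto simp: adj_eq_form_complement)
  show "adj (W 1 kappa_plus) \<subseteq> W (-1) kappa_minus"
  proof
    fix u assume u: "u \<in> adj (W 1 kappa_plus)"
    \<comment> \<open>Varying \<open>s\<close>, \<open>z\<close> and \<open>n\<close> separately
      yields the three defining equations of \<open>W (-1) kappa_minus\<close>.\<close>
    have test: "cinner s (J (xc u) + Gs (n1 u)) + cinner (J (z + F n)) (xc u)
        + cinner (kappa_plus n - Fs (J z)) (nn u) + cinner n (n1 u) = 0"
      if "s \<in> L" "z \<in> K1" "J z = z" "n \<in> ortho H0" for s z n
    proof -
      define a where "a = kappa_plus n - Fs (J z)"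
      define t where "t = mk (s + (z + F n) - J (Gs a)) a (n + G s)"
      note pt = W_parametrization[where \<sigma> = 1 and \<kappa> = kappa_plus, OF that(1,2) _ that(4) a_def kappa_plus_N[OF that(4)], folded t_def]
      have tW: "t \<in> W 1 kappa_plus" using pt(1) that(3) by simp
      have t: "PL (J (xc t)) = - Gs (n1 t)" using tW by (simp add: W_def)
      have "cinner (J t) u = 0" using u tW by (simp add: adj_eq_form_complement)
      thus ?thesis
        unfolding half_pair[OF t] using pt that(3) by (simp add: a_def)
    qed
    have K0: "0 \<in> K1" "0 \<in> L" using closed_subspaceD(1) cs_K1 cs_L by blast+
    have z0: "kappa_plus 0 = 0" "F 0 = 0" "Fs 0 = 0" 
      using is_adj_kp is_adj_F is_adj_commute is_adj_0 by metis+
    have "cinner s (J (xc u) + Gs (n1 u)) = 0" if "s \<in> L" for s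
      using test[OF that K0(1) _ ND(1)] by (simp add: z0 lin)
    hence "J (xc u) + Gs (n1 u) \<in> ortho L"
      by (simp add: ortho_def cinner_eq_0_commute)
    hence "PL (J (xc u) + Gs (n1 u)) = 0" by (simp add: PL_def proj_eq_0 cs_L)
    hence 1: "PL (J (xc u)) = - Gs (n1 u)"
      using idem(1)[OF Gs_L] by (simp add: lin eq_neg_iff_add_eq_0)
    have zt: "cinner z (zz u) = 0" if z: "z \<in> K1" "J z = z" for z
      using test[OF K0(2) z ND(1)] z(2) cinner_P1[OF z(1), of "xc u"] is_adjD[OF is_adj_commute[THEN iffD1, OF is_adj_F], of z]
      by (simp add: z0 zz_def cinner_simps)
    \<comment> \<open>The test vector is twice the component of \<open>zz u\<close> in the
      eigenspace of \<open>J\<close> for 1.\<close>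
    have "cinner (zz u + J (zz u)) (zz u) = 0"
      using zz_K1 J_K1 by (intro zt K1_closed) (simp_all add: lin)
    moreover have "cinner (zz u + J (zz u)) (J (zz u)) = cinner (zz u + J (zz u)) (zz u)"
      by (simp add: cinner_simps is_adjD[OF is_adj_J])
    ultimately have "cinner (zz u + J (zz u)) (zz u + J (zz u)) = 0"
      by (simp add: cinner_add_right)
    hence 2: "J (zz u) = - zz u" by (simp add: eq_neg_iff_add_eq_0 add.commute)
    have "cinner n (Fs (J (zz u)) - kappa_minus (nn u) + n1 u) = 0" if n: "n \<in> ortho H0" for n
    proof -
      have "cinner (J (F n)) (xc u) = cinner (J (F n)) (zz u) + cinner (J (F n)) (F (nn u))"
        using cinner_P1[OF J_K1[OF F_K1(1)], of n "xc u"] by (simp add: zz_def cinner_simps)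
      moreover have "cinner (J (F n)) (zz u) = cinner n (Fs (J (zz u)))"
        by (simp add: is_adjD[OF is_adj_J] is_adjD[OF is_adj_F])
      ultimately show ?thesis
        using test[OF K0(2) K0(1) _ n] duality[of n "nn u"]
        by (simp add: z0 lin cinner_simps) algebra
    qed
    moreover have "Fs (J (zz u)) - kappa_minus (nn u) + n1 u \<in> ortho H0"
      by (intro ND Fs_N kappa_minus_N n_N)
    ultimately have "Fs (J (zz u)) - kappa_minus (nn u) + n1 u = 0"
      using cinner_self_eq_0 by blast
    thus "u \<in> W (-1) kappa_minus"
      using 1 2 by (simp add: W_def algebra_simps)
  qed
qed

lemma closed_subspace_W: "closed_subspace (W 1 kappa_plus)"
proof -
  note bc = is_adj_bounded_clinear
  have pr: "bounded_clinear (\<lambda>t. proj H0 (fst t))" "bounded_clinear (\<lambda>t. proj H0 (snd t))"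
    by (rule bounded_clinear_compose[OF bc[OF is_adj_proj[OF H0]]], rule bounded_clinear_fst bounded_clinear_snd)+
  have xc: "bounded_clinear xc"
    unfolding xc_def by (intro bounded_clinear_Pair pr)
  have n1: "bounded_clinear n1"
    unfolding n1_def by (intro bounded_clinear_diff bounded_clinear_fst pr)
  have "bounded_clinear (\<lambda>t. (-\<i>) *\<^sub>C (snd t - proj H0 (snd t)))"
    by (intro bounded_clinear_scaleC bounded_clinear_diff bounded_clinear_snd pr)
  hence n2: "bounded_clinear n2" unfolding n2_def by simp
  have nn: "bounded_clinear nn"
    unfolding nn_def by (intro bounded_clinear_diff n2 bounded_clinear_compose[OF bc[OF G(1)] xc])
  have zz: "bounded_clinear zz"
    unfolding zz_def
    by (intro bounded_clinear_diff bounded_clinear_compose[OF bc[OF is_adj_F] nn] bounded_clinear_compose[OF bc[OF adjs(8)] xc])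
  have Jz: "bounded_clinear (\<lambda>t. J (zz t))" by (rule bounded_clinear_compose[OF bc[OF is_adj_J] zz])
  have "W 1 kappa_plus = {t. J (zz t) - zz t = 0} \<inter> {t. PL (J (xc t)) + Gs (n1 t) = 0} \<inter>
      {t. n1 t - (kappa_plus (nn t) - Fs (J (zz t))) = 0}"
    by (auto simp: W_def eq_neg_iff_add_eq_0)
  also have "closed_subspace \<dots>"
  proof (intro closed_subspace_Int closed_subspace_kernel)
    show "bounded_clinear (\<lambda>t. J (zz t) - zz t)" by (intro bounded_clinear_diff Jz zz)
    show "bounded_clinear (\<lambda>t. PL (J (xc t)) + Gs (n1 t))"
      by (intro bounded_clinear_add bounded_clinear_compose[OF bc[OF adjs(7)]]
          bounded_clinear_compose[OF bc[OF is_adj_J] xc]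
          bounded_clinear_compose[OF bc[OF is_adj_commute[THEN iffD1, OF G(1)]] n1])
    show "bounded_clinear (\<lambda>t. n1 t - (kappa_plus (nn t) - Fs (J (zz t))))"
      by (intro bounded_clinear_diff n1 bounded_clinear_compose[OF bc[OF is_adj_kp] nn]
          bounded_clinear_compose[OF bc[OF is_adj_commute[THEN iffD1, OF is_adj_F]] Jz])
  qed
  finally show ?thesis .
qed

section \<open>Compressions of \<open>W\<close> to \<open>H0\<close>\<close>

text \<open>First components in \<open>H0\<close> mean \<open>n1 t = 0\<close>, and then
  \<open>kernel_trivial\<close> applies. The last claim serves single-valuedness.\<close>

lemma W_reduction:
  assumes t: "t \<in> W \<sigma> \<kappa>" "n1 t = 0" and \<sigma>: "\<sigma> = 1 \<and> \<kappa> = kappa_plus \<or> \<sigma> = -1 \<and> \<kappa> = kappa_minus"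
  shows "\<sigma> = 1 \<Longrightarrow> xc t \<in> A" "\<sigma> = -1 \<Longrightarrow> xc t \<in> B" "xc t = 0 \<Longrightarrow> t = 0"
proof -
  have eq: "(if \<sigma> = 1 then kappa_plus (nn t) else kappa_minus (nn t)) = Fs (J (zz t))"
    and Jz: "J (zz t) = \<sigma> *\<^sub>R zz t" and s1: "\<sigma> = 1 \<or> \<sigma> = - 1"
    using t \<sigma> by (auto simp: W_def)
  note r = kernel_trivial[OF zz_K1 Jz s1 eq]
  have "PL (J (xc t)) = 0" using t by (simp add: W_def lin)
  hence "xc t = PL (xc t) + P1 (xc t)"
    using decomposition[OF xc_H0[of t]] by (simp add: lin)
  moreover have "P1 (xc t) = F (nn t)" using r by (simp add: zz_def)
  ultimately have x: "xc t = PL (xc t) + (av (nn t) + bv (nn t))" using r by (simp add: F_def)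
  have LA: "PL (xc t) \<in> A" "PL (xc t) \<in> B" using ranges(1) by (auto simp: L_def)
  show "xc t \<in> A" if "\<sigma> = 1"
    using r that LA ranges(3) closed_subspaceD(2)[OF A(1)] by (subst x) (simp add: av_def)
  show "xc t \<in> B" if "\<sigma> = -1"
    using r that LA ranges(4) closed_subspaceD(2)[OF B(1)] by (subst x) (simp add: bv_def)
  show "t = 0" if x0: "xc t = 0"
  proof -
    have "av (nn t) + bv (nn t) = 0" using x x0 by (simp add: lin)
    hence "av (nn t) = 0" "bv (nn t) = 0" using r s1 by auto
    hence "nn t = 0" using r s1 by (auto simp: lin)
    hence "n2 t = 0" using x0 by (simp add: nn_def lin)
    thus ?thesis using mk_coords[of t] x0 t(2) by (simp add: mk_def zero_prod_def)
  qed
qed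

text \<open>For the part \<open>x1\<close> of \<open>x\<close> orthogonal to \<open>L\<close>,
  \<open>U0 x1\<close> lies in the kernel of \<open>kappa_plus\<close> and \<open>F\<close> maps it
  back to \<open>x1\<close>.\<close>

lemma lift_A:
  assumes x: "x \<in> A"
  shows "mk x 0 (U0 (x - PL x) + G x) \<in> W 1 kappa_plus"
proof -
  define x1 where "x1 = x - PL x"
  have x1: "x1 \<in> ortho L" unfolding x1_def PL_def by (rule proj_ortho[OF cs_L])
  have "x1 \<in> A" unfolding x1_def using x ranges(1) closed_subspaceD(5)[OF A(1)] by (auto simp: L_def)
  hence p: "p x1 = x1" using x1 idem by simp
  have v: "av (U0 x1) = x1" "bv (U0 x1) = 0" "vv (U0 x1) = 0"
    by (simp_all add: av_def bv_def vv_def U0 U_orth p lin)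
  have k: "kappa_plus (U0 x1) = 0" by (simp add: kappa_plus_def kappa0_def v lin VU)
  have "mk (PL x + (0 + F (U0 x1)) - J (Gs 0)) 0 (U0 x1 + G (PL x)) \<in> W 1 kappa_plus"
    using closed_subspaceD(1)[OF cs_K1] closed_subspaceD(1)[OF closed_subspace_ortho] is_adj_0[OF is_adj_commute[THEN iffD1, OF is_adj_F]]
    by (intro W_parametrization ranges U0) (simp_all add: lin k)
  moreover have "PL x + (0 + F (U0 x1)) - J (Gs 0) = x"
    by (simp add: F_def v lin) (simp add: x1_def)
  ultimately show ?thesis using G_PL[of x] by (simp add: x1_def)
qed

lemma lift_B:
  assumes x: "x \<in> B"
  shows "mk x 0 (U1 (x - PL x) + G x) \<in> W (-1) kappa_minus"
proof -
  define x1 where "x1 = x - PL x"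
  have x1: "x1 \<in> ortho L" unfolding x1_def PL_def by (rule proj_ortho[OF cs_L])
  have "x1 \<in> B" unfolding x1_def using x ranges(1) closed_subspaceD(5)[OF B(1)] by (auto simp: L_def)
  hence p: "q x1 = x1" using x1 idem by simp
  have v: "bv (U1 x1) = x1" "av (U1 x1) = 0" "vv (U1 x1) = 0"
    by (simp_all add: av_def bv_def vv_def U1 U_orth p lin)
  have k: "kappa_minus (U1 x1) = 0" by (simp add: kappa_minus_def kappa0_def v lin VU)
  have "mk (PL x + (0 + F (U1 x1)) - J (Gs 0)) 0 (U1 x1 + G (PL x)) \<in> W (-1) kappa_minus"
    using closed_subspaceD(1)[OF cs_K1] closed_subspaceD(1)[OF closed_subspace_ortho] is_adj_0[OF is_adj_commute[THEN iffD1, OF is_adj_F]]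
    by (intro W_parametrization ranges U1) (simp_all add: lin k)
  moreover have "PL x + (0 + F (U1 x1)) - J (Gs 0) = x"
    by (simp add: F_def v lin) (simp add: x1_def)
  ultimately show ?thesis using G_PL[of x] by (simp add: x1_def)
qed

lemma n1_0: "t \<in> H0 \<times> UNIV \<Longrightarrow> n1 t = 0"
  using proj_eq_self[OF H0] by (auto simp: n1_def)

lemma compression_W:
  assumes "\<sigma> = 1 \<and> \<kappa> = kappa_plus \<and> C = A \<or> \<sigma> = -1 \<and> \<kappa> = kappa_minus \<and> C = B"
  shows "compression H0 (W \<sigma> \<kappa>) = C"
proof
  show "compression H0 (W \<sigma> \<kappa>) \<subseteq> C"
  proof
    fix x assume "x \<in> compression H0 (W \<sigma> \<kappa>)"
    then obtain f h where t: "x = (f, proj H0 h)" "(f, h) \<in> W \<sigma> \<kappa>" "f \<in> H0"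
      by (auto simp: compression_def)
    have "xc (f, h) = x" using t proj_eq_self[OF H0] by (simp add: xc_def)
    thus "x \<in> C"
      using W_reduction(1,2)[OF t(2) n1_0] t(3) assms by auto
  qed
  show "C \<subseteq> compression H0 (W \<sigma> \<kappa>)"
  proof
    fix x assume x: "x \<in> C"
    obtain b where b: "mk x 0 b \<in> W \<sigma> \<kappa>" "b \<in> ortho H0"
      using assms lift_A lift_B x ND(2)[OF U0(3) G(2)] ND(2)[OF U1(3) G(2)] by metis
    have xH: "x \<in> H0 \<times> H0" using assms x A B by auto
    have "xc (mk x 0 b) = x" by (rule xc_mk[OF xH ND(1) b(2)])
    hence "x = (fst (mk x 0 b), proj H0 (snd (mk x 0 b)))"
      using xH proj_eq_self[OF H0] by (auto simp: xc_def mk_def)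
    moreover have "fst (mk x 0 b) \<in> H0" using xH by (auto simp: mk_def)
    ultimately show "x \<in> compression H0 (W \<sigma> \<kappa>)"
      using b(1) unfolding compression_def by (metis (mono_tags, lifting) mem_Collect_eq prod.collapse)
  qed
qed

lemma maximal_dissipative_W:
  assumes "single_valued A" shows "maximal_dissipative (W 1 kappa_plus)"
proof (rule maximal_dissipativeI)
  note cs = closed_subspaceD[OF closed_subspace_W]
  show "operator_in UNIV (W 1 kappa_plus)"
    unfolding operator_in_def
  proof (intro conjI allI impI)
    show "single_valued (W 1 kappa_plus)"
    proof (rule single_valuedI)
      fix f h h' assume "(f, h) \<in> W 1 kappa_plus" "(f, h') \<in> W 1 kappa_plus"
      \<comment> \<open>Its first component 0 lies in \<open>H0\<close>, so the compression result
        reduces the claim to the single-valuedness of \<open>A\<close>.\<close>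
      hence t: "(0, h - h') \<in> W 1 kappa_plus" using cs(5) by fastforce
      have n: "n1 (0, h - h') = 0" using closed_subspaceD(1)[OF H0] by (intro n1_0) simp
      have "xc (0, h - h') \<in> A" using W_reduction(1)[OF t n] by simp
      moreover have x: "xc (0, h - h') = (0, proj H0 (h - h'))"
        using closed_subspaceD(1)[OF H0] proj_eq_self[OF H0] by (simp add: xc_def)
      moreover have "(0, 0) \<in> A" using closed_subspaceD(1)[OF A(1)] by (simp add: zero_prod_def)
      ultimately have "xc (0, h - h') = 0"
        using assms by (auto simp: single_valued_def zero_prod_def)
      hence "(0, h - h') = (0 :: 'a \<times> 'a)" using W_reduction(3)[OF t n] by simp
      thus "h = h'" by (simp add: zero_prod_def)
    qed
    show "(0, 0) \<in> W 1 kappa_plus" using cs(1) by (simp add: zero_prod_def)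
    show "(f + f', h + h') \<in> W 1 kappa_plus" if "(f, h) \<in> W 1 kappa_plus" "(f', h') \<in> W 1 kappa_plus" for f h f' h'
      using cs(2)[OF that] by simp
    show "(c *\<^sub>C f, c *\<^sub>C h) \<in> W 1 kappa_plus" if "(f, h) \<in> W 1 kappa_plus" for c f h
      using cs(3)[OF that, of c] by simp
  qed simp
  show "closed (W 1 kappa_plus)" by (rule cs)
  show "dissipative (W 1 kappa_plus)" using W_nonneg by (simp add: dissipative_eq)
  show "Re (cinner (J t) t) \<le> 0" if "t \<in> adj (W 1 kappa_plus)" for t
    using that W_nonpos unfolding adj_W by simp
qed

lemma lift_L:
  assumes "x \<in> A \<inter> B" shows "x + (0, \<i> *\<^sub>C G x) \<in> W 1 kappa_plus"
proof -
  have "PL x = x" using assms by (intro idem) (simp add: L_def)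
  thus ?thesis using lift_A[of x] assms by (simp add: mk_def lin)
qed

end

section \<open>Existence of the auxiliary operators\<close>

lemma transport_transport:
  assumes a: "suborthonormal a" and b: "suborthonormal b" "\<And>m. norm (b m) = 1"
  shows "transport b c (transport a b x) = transport a c x"
proof -
  have "cinner (transport a b x) (b m) = cinner x (a m)" for m
    using is_adjD[OF is_adj_transport[OF a b(1)], of x "b m"] b(2) by (simp add: transport_basis[OF b(1)])
  thus ?thesis by (simp add: transport_def)
qed

lemma transport_orthogonal:
  assumes a: "suborthonormal a" and b: "suborthonormal b" and "\<And>m. cinner y (b m) = 0"
  shows "cinner (transport a b x) y = 0"
  by (simp add: is_adjD[OF is_adj_transport[OF a b]] transport_eq_0 assms(3))

text \<open>First differences are constant and tend to zero; the sequence is then constant with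
  limit zero.\<close>

lemma linear_recurrence_tendsto_0:
  fixes c :: "nat \<Rightarrow> 'a::real_normed_vector"
  assumes rec: "\<And>k. 2 *\<^sub>R c (Suc k) = c k + c (Suc (Suc k))" and lim: "c \<longlonglongrightarrow> 0"
  shows "c k = 0"
proof -
  have "c (Suc (Suc k)) - c (Suc k) = c (Suc k) - c k" for k
    using rec[of k] by (simp add: scaleR_2 algebra_simps)
  hence d: "c (Suc k) - c k = c 1 - c 0" for k
    by (induction k) simp_all
  have "(\<lambda>k. c (Suc k) - c k) \<longlonglongrightarrow> 0 - 0"
    by (intro tendsto_diff LIMSEQ_Suc lim)
  hence "(\<lambda>k::nat. c 1 - c 0) \<longlonglongrightarrow> 0" unfolding d by simp
  hence "c 1 - c 0 = 0" using LIMSEQ_const_iff by blast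
  hence "c (Suc k) = c k" for k using d[of k] by simp
  hence "c k = c 0" for k by (induction k) simp_all
  hence "c = (\<lambda>_. c 0)" by (simp add: fun_eq_iff)
  thus ?thesis using lim LIMSEQ_const_iff by metis
qed

text \<open>The sequence \<open>e\<close> is rearranged into infinitely many orthonormal sequences
  \<open>E k\<close>. The first three carry copies of the source space, and \<open>V\<close> moves
  \<open>E k\<close> to \<open>E (k + 1)\<close> from \<open>k = 2\<close> on.\<close>

lemma ex_chain_isometries:
  fixes d :: "nat \<Rightarrow> 'b::complex_hilbert" and e :: "nat \<Rightarrow> 'a::complex_hilbert"
  assumes d: "suborthonormal d" "\<And>x. transport d d x = x"
    and e: "suborthonormal e" "\<And>m. e m \<in> ortho H" "\<And>m. norm (e m) = 1"
  shows "\<exists>U0 U1 U2 :: 'b \<Rightarrow> 'a. \<exists>U0s U1s U2s V Vs. chain_isometries (ortho H) U0 U1 U2 U0s U1s U2s V Vs"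
proof -
  define E where "E k j = e (prod_encode (j, k))" for j k
  \<comment> \<open>\<open>X l\<close> enumerates all \<open>E k\<close> with
    \<open>l \<le> k\<close>, in the same order for every \<open>l\<close>, so that transport from
    \<open>X 2\<close> to \<open>X 3\<close> raises \<open>k\<close> by one.\<close>
  define X where "X l m = E (snd (prod_decode m) + l) (fst (prod_decode m))" for l m
  have E1: "norm (E k j) = 1" for j k by (simp add: E_def e)
  have E0: "cinner (E k j) (E k' j') = 0" if "(j, k) \<noteq> (j', k')" for j k j' k'
    using e(1) that unfolding E_def suborthonormal_def by (metis prod_encode_eq)
  have E: "suborthonormal (E k)" for k
    using E0 E1 by (simp add: suborthonormal_def)
  have X: "suborthonormal (X l)" for l
    unfolding suborthonormal_def
  proof (intro conjI allI impI)
    fix i j :: nat assume "i \<noteq> j"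
    hence "prod_decode i \<noteq> prod_decode j" by (simp add: prod_decode_eq)
    thus "cinner (X l i) (X l j) = 0"
      unfolding X_def by (intro E0) (auto simp: prod_eq_iff)
  qed (simp add: X_def E1)
  have XE: "cinner (X l m) (E k j) = 0" "cinner (E k j) (X l m) = 0" if "k < l" for k l m j
    using that unfolding X_def by (intro E0; simp)+
  have HE: "cinner y (E k j) = 0" if "y \<in> H" for y k j
    unfolding E_def using orthoD(2)[OF e(2) that] .
  have HX: "cinner y (X l j) = 0" if "y \<in> H" for y l j
    unfolding X_def using HE[OF that] .
  define U where "U k = transport d (E k)" for k
  define Us where "Us k = transport (E k) d" for k
  define V where "V = transport (X 2) (X 3)"
  define Vs where "Vs = transport (X 3) (X 2)"
  have U: "is_adj (U k) (Us k)" for k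
    unfolding U_def Us_def by (rule is_adj_transport[OF d(1) E])
  have UU: "Us k (U k x) = x" for k x
    unfolding U_def Us_def by (simp add: transport_transport[OF d(1) E E1] d(2))
  have UN: "U k x \<in> ortho H" for k x
    unfolding U_def ortho_def using transport_orthogonal[OF d(1) E] HE by auto
  have Uo: "Us k (U l x) = 0" if "k \<noteq> l" for k l x
    unfolding U_def Us_def
    using that by (intro transport_eq_0 transport_orthogonal[OF d(1) E] E0) simp
  have Va: "is_adj V Vs" unfolding V_def Vs_def by (rule is_adj_transport[OF X X])
  have Vn: "norm (V n) \<le> norm n" for n unfolding V_def by (rule norm_transport_le[OF X X])
  have VN: "V n \<in> ortho H" "Vs n \<in> ortho H" for n
    unfolding V_def Vs_def ortho_def using transport_orthogonal[OF X X] HX by auto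
  have VU: "V (U k x) = 0" "Vs (U k x) = 0" if "k < 2" for k x
    unfolding V_def Vs_def U_def
    using that by (intro transport_eq_0 transport_orthogonal[OF d(1) E] XE; simp)+
  have XS: "X l (prod_encode (j, k)) = E (k + l) j" for l j k by (simp add: X_def)
  have VE: "V (E (k + 2) j) = E (k + 3) j" "Vs (E (k + 3) j) = E (k + 2) j" for j k
    using transport_basis[OF X, of 2 "X 3" "prod_encode (j, k)"] transport_basis[OF X, of 3 "X 2" "prod_encode (j, k)"]
    by (simp_all add: V_def Vs_def XS E1)
  have UE: "Us l (E (k + 3) j) = 0" if "l < 3" for l k j
    unfolding Us_def using that by (intro transport_eq_0 E0) simp
  have chain: "V n = 0 \<and> Vs n = 0 \<and> Us 2 n = 0"
    if eq: "2 *\<^sub>R n - V n - Vs n = U 2 u + U 0 x + U 1 y" for n u x y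
  proof -
    have c0: "cinner n (E (k + 2) j) = 0" for k j
    proof (rule linear_recurrence_tendsto_0[of "\<lambda>k. cinner n (E (k + 2) j)"])
      have "suborthonormal (\<lambda>k. E (k + 2) j)"
        using E0 E1 by (simp add: suborthonormal_def)
      thus "(\<lambda>k. cinner n (E (k + 2) j)) \<longlonglongrightarrow> 0" by (rule coefficients_tendsto_0)
      fix k
      \<comment> \<open>Testing starts at \<open>E 3\<close>, since \<open>U 2 u\<close> has its
        components along \<open>E 2\<close>.\<close>
      have "cinner (2 *\<^sub>R n - V n - Vs n) (E (k + 3) j) = 0"
        unfolding eq by (simp add: cinner_simps is_adjD[OF U] UE)
      moreover have "cinner (V n) (E (k + 3) j) = cinner n (E (k + 2) j)"
        by (simp add: is_adjD[OF Va] VE)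
      moreover have "cinner (Vs n) (E (k + 3) j) = cinner n (E (k + 4) j)"
        using VE(1)[of "Suc k" j] is_adjD[OF Va[THEN is_adj_commute[THEN iffD1]], of n "E (k + 3) j"]
        by (simp add: eval_nat_numeral)
      ultimately show "2 *\<^sub>R cinner n (E (Suc k + 2) j) = cinner n (E (k + 2) j) + cinner n (E (Suc (Suc k) + 2) j)"
        by (simp add: cinner_simps eval_nat_numeral scaleR_conv_of_real) (simp add: algebra_simps)
    qed
    have "cinner n (X 2 m) = 0" "cinner n (X 3 m) = 0" "cinner n (E 2 m) = 0" for m
      using c0[of "snd (prod_decode m)"] c0[of "Suc (snd (prod_decode m))"] c0[of 0]
      by (simp_all add: X_def eval_nat_numeral)
    thus ?thesis by (simp add: V_def Vs_def Us_def transport_eq_0)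
  qed
  have "chain_isometries (ortho H) (U 0) (U 1) (U 2) (Us 0) (Us 1) (Us 2) V Vs"
    by unfold_locales (use U UU UN Uo Va Vn VN VU chain in auto)
  thus ?thesis by blast
qed

section \<open>The component of \<open>S\<close> orthogonal to the closure of its domain\<close>

lemma operator_in_subspace: "operator_in K T \<Longrightarrow> complex_hilbert.subspace T"
  by (auto simp: complex_hilbert.subspace_def operator_in_def zero_prod_def)

text \<open>\<open>- \<i>\<close> times the component of \<open>S\<close> orthogonal to \<open>H\<close>, as a function of the points of the closed
  graph of the compressed operator. Being closed and defined everywhere, it is bounded.\<close>

lemma ex_orthogonal_component:
  fixes S :: "'a::complex_hilbert operator"
  assumes S: "operator_in UNIV S" "closed S" and S0: "closed {(f, proj H h) | f h. (f, h) \<in> S}"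
    and H: "closed_subspace H" "Domain S \<subseteq> H"
  shows "\<exists>G Gs. is_adj G Gs \<and> (\<forall>x. G x \<in> ortho H) \<and> (\<forall>y. Gs y \<in> {(f, proj H h) | f h. (f, h) \<in> S}) \<and>
    (\<forall>(f, h)\<in>S. (f, h) = (f, proj H h) + (0, \<i> *\<^sub>C G (f, proj H h)))"
proof -
  let ?S0 = "{(f, proj H h) | f h. (f, h) \<in> S}"
  have cS: "closed_subspace S" using S operator_in_subspace by (auto simp: closed_subspace_def)
  note SD = closed_subspaceD[OF cS]
  have sv: "h = h'" if "(f, h) \<in> S" "(f, h') \<in> S" for f h h'
    using that S by (auto simp: operator_in_def single_valued_def)
  have pl: "proj H (x + y) = proj H x + proj H y" "proj H (c *\<^sub>C x) = c *\<^sub>C proj H x" "proj H 0 = 0" for x y c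
    using is_adj_add is_adj_scaleC is_adj_0 is_adj_proj[OF H(1)] by metis+
  have "complex_hilbert.subspace ?S0"
    unfolding complex_hilbert.subspace_def
  proof (intro conjI ballI allI)
    show "0 \<in> ?S0" using SD(1) pl(3) by (force simp: zero_prod_def)
    show "x + y \<in> ?S0" if xy: "x \<in> ?S0" "y \<in> ?S0" for x y
    proof -
      obtain f h f' h' where "x = (f, proj H h)" "(f, h) \<in> S" "y = (f', proj H h')" "(f', h') \<in> S"
        using xy by blast
      hence "x + y = (f + f', proj H (h + h'))" "(f + f', h + h') \<in> S"
        using SD(2)[of "(f, h)" "(f', h')"] by (simp_all add: pl)
      thus ?thesis by blast
    qed
    show "c *\<^sub>C x \<in> ?S0" if x: "x \<in> ?S0" for c x
    proof -
      obtain f h where "x = (f, proj H h)" "(f, h) \<in> S" using x by blast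
      hence "c *\<^sub>C x = (c *\<^sub>C f, proj H (c *\<^sub>C h))" "(c *\<^sub>C f, c *\<^sub>C h) \<in> S"
        using SD(3)[of "(f, h)" c] by (simp_all add: pl)
      thus ?thesis by blast
    qed
  qed
  hence cS0: "closed_subspace ?S0" using S0 by (simp add: closed_subspace_def)
  \<comment> \<open>Composing with this projection extends the component from the graph
    \<open>?S0\<close> to the whole product.\<close>
  define p where "p = proj ?S0"
  have padj: "is_adj p p" unfolding p_def by (rule is_adj_proj[OF cS0])
  have pS0: "p x \<in> ?S0" and p_id: "x \<in> ?S0 \<Longrightarrow> p x = x" for x
    unfolding p_def by (rule proj_in[OF cS0], rule proj_eq_self[OF cS0])
  have "\<exists>y. y \<in> ortho H \<and> p x + (0, \<i> *\<^sub>C y) \<in> S" for x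
  proof -
    obtain f h where fh: "(f, h) \<in> S" "p x = (f, proj H h)"
      using pS0[of x] by auto
    have "(- \<i>) *\<^sub>C (h - proj H h) \<in> ortho H"
      by (intro closed_subspaceD(3)[OF closed_subspace_ortho] proj_ortho H)
    moreover have "\<i> *\<^sub>C (- \<i>) *\<^sub>C (h - proj H h) = h - proj H h"
      unfolding scaleC_scaleC by simp
    hence "p x + (0, \<i> *\<^sub>C (- \<i>) *\<^sub>C (h - proj H h)) = (f, h)"
      unfolding fh(2) by simp
    hence "p x + (0, \<i> *\<^sub>C (- \<i>) *\<^sub>C (h - proj H h)) \<in> S"
      by (simp only: fh(1))
    ultimately show ?thesis by (intro exI conjI)
  qed
  then obtain G where G: "\<And>x. G x \<in> ortho H" "\<And>x. p x + (0, \<i> *\<^sub>C G x) \<in> S" by metis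
  have uniq: "y = G x" if "p x + (0, \<i> *\<^sub>C y) \<in> S" for x y
  proof -
    have "\<i> *\<^sub>C y = \<i> *\<^sub>C G x"
      using sv[of "fst (p x)" "snd (p x) + \<i> *\<^sub>C y" "snd (p x) + \<i> *\<^sub>C G x"] that G(2)[of x]
      by (cases "p x") simp
    hence "(- \<i>) *\<^sub>C \<i> *\<^sub>C y = (- \<i>) *\<^sub>C \<i> *\<^sub>C G x" by metis
    thus ?thesis unfolding scaleC_scaleC by simp
  qed
  have "\<exists>Gs. is_adj G Gs"
  proof (rule closed_graph_adjoint)
    show "G (x + y) = G x + G y" for x y
    proof (rule uniq[symmetric])
      show "p (x + y) + (0, \<i> *\<^sub>C (G x + G y)) \<in> S"
        using SD(2)[OF G(2)[of x] G(2)[of y]]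
        by (cases "p x"; cases "p y") (simp add: is_adj_add[OF padj] scaleC_add_right algebra_simps)
    qed
    show "G (c *\<^sub>C x) = c *\<^sub>C G x" for c x
    proof (rule uniq[symmetric])
      show "p (c *\<^sub>C x) + (0, \<i> *\<^sub>C c *\<^sub>C G x) \<in> S"
        using SD(3)[OF G(2)[of x], of c]
        by (cases "p x") (simp add: is_adj_scaleC[OF padj] scaleC_add_right scaleC_scaleC mult.commute)
    qed
    let ?m = "\<lambda>t. p (fst t) + (0, \<i> *\<^sub>C snd t)"
    have "range (\<lambda>x. (x, G x)) = ?m -` S"
      using G(2) uniq by (auto simp: image_iff)
    moreover have "bounded_clinear ?m"
      by (intro bounded_clinear_add bounded_clinear_compose[OF is_adj_bounded_clinear[OF padj]] bounded_clinear_fst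
          bounded_clinear_Pair bounded_clinear_scaleC bounded_clinear_snd)
        (simp add: bounded_clinear_def)
    ultimately show "closed (range (\<lambda>x. (x, G x)))"
      using SD(4) by (auto simp: bounded_clinear_def intro!: continuous_closed_vimage linear_continuous_at)
  qed
  then obtain Gs where Gs: "is_adj G Gs" by blast
  \<comment> \<open>Passing to adjoints, \<open>p\<close> fixes the range of \<open>Gs\<close>,
    which therefore lies in \<open>?S0\<close>.\<close>
  have Gp: "G x = G (p x)" for x
    by (rule uniq) (simp add: p_id[OF pS0] G)
  have pGs: "p (Gs y) = Gs y" for y
  proof (rule cinner_ext)
    fix x
    have "cinner x (Gs y) = cinner x (p (Gs y))"
      using is_adjD[OF Gs, of x y] is_adjD[OF Gs, of "p x" y] Gp[of x] is_adjD[OF padj, of x "Gs y"] by simp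
    thus "cinner (p (Gs y)) x = cinner (Gs y) x" by (metis cinner_commute)
  qed
  have GsS: "Gs y \<in> ?S0" for y using pS0[of "Gs y"] unfolding pGs .
  have "(f, h) = (f, proj H h) + (0, \<i> *\<^sub>C G (f, proj H h))" if "(f, h) \<in> S" for f h
  proof -
    have "p (f, proj H h) = (f, proj H h)" using that by (intro p_id) blast
    hence "(f, proj H h + \<i> *\<^sub>C G (f, proj H h)) \<in> S" using G(2)[of "(f, proj H h)"] by simp
    from sv[OF that this] show ?thesis by simp
  qed
  thus ?thesis using Gs G(1) GsS by blast
qed

theorem theorem8p4:
  fixes S A B :: "'a::complex_hilbert operator"
  assumes separable: "\<exists>D :: 'a set. countable D \<and> closure D = UNIV"
    and infinite_dim: "hdim (UNIV :: 'a set) = \<infinity>"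
    and S: "operator_in UNIV S" "symmetric_op S" "closed S" "regular S"
    and not_dense: "dom_closure S \<noteq> UNIV"
    and indices: "semi_def_index_plus S \<noteq> 0" "semi_def_index_minus S \<noteq> 0"
    and codim: "hdim (ortho (Domain S)) = \<infinity>"
    and pair: "dual_pair (dom_closure S) A B"
    and closed_ext: "closed A" "closed B" "op0 S \<subseteq> A" "op0 S \<subseteq> B"
    and diss: "dissipative A" "dissipative (neg_op B)"
    and dom_A: "Domain A \<inter> Domain B = {f | f h. (f, h) \<in> A \<and> Im (cinner h f) = 0}"
    and dom_B: "Domain A \<inter> Domain B = {g | g k. (g, k) \<in> B \<and> Im (cinner k g) = 0}"
  shows "\<exists>T. maximal_dissipative T \<and> S \<subseteq> T \<and>
           compression (dom_closure S) T = A \<and>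
           compression (dom_closure S) (adj T) = B"
proof -
  define H where "H = dom_closure S"
  have "complex_hilbert.subspace (Domain S)"
    using S(1) by (fastforce simp: complex_hilbert.subspace_def operator_in_def)
  hence H: "closed_subspace H" unfolding H_def dom_closure_def by (rule closed_subspace_closure)
  have orthoH: "ortho (Domain S) = ortho H" by (simp add: H_def dom_closure_def ortho_closure)
  have DH: "Domain S \<subseteq> H" by (simp add: H_def dom_closure_def closure_subset)
  have op: "operator_in H A" "operator_in H B"
    using pair by (auto simp: dual_pair_def H_def)
  have dual: "cinner (J a) b = 0" if "a \<in> A" "b \<in> B" for a b
  proof -
    have "cinner (snd a) (fst b) = cinner (fst a) (snd b)"
      using pair that unfolding dual_pair_def by (auto simp: case_prod_unfold)
    thus ?thesis by (simp add: cinner_J)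
  qed
  have cs: "closed_subspace A" "closed_subspace B"
    using op closed_ext operator_in_subspace by (auto simp: closed_subspace_def)
  have S0: "op0 S = {(f, proj H h) | f h. (f, h) \<in> S}" by (simp add: op0_def H_def)

  \<comment> \<open>Both \<open>A\<close> and \<open>B\<close> extend the compressed
    \<open>S\<close>, so duality gives \<open>h\<close> and \<open>k\<close> the same inner products
    with the dense domain of \<open>S\<close>.\<close>
  have agree: "h = k" if a: "(f, h) \<in> A" "(f, k) \<in> B" for f h k
  proof -
    have "cinner (h - k) f' = 0" if f': "f' \<in> Domain S" for f'
    proof -
      obtain h'' where "(f', h'') \<in> S" using f' by blast
      then obtain h' where s: "(f', h') \<in> op0 S" unfolding S0 by blast
      have "cinner (J (f, h)) (f', h') = 0" "cinner (J (f', h')) (f, k) = 0"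
        using dual a s closed_ext by blast+
      hence "cinner h f' = cinner f h'" "cinner h' f = cinner f' k" by (simp_all add: cinner_J)
      thus ?thesis by (metis cinner_commute cinner_diff_left right_minus_eq)
    qed
    hence "h - k \<in> ortho H" unfolding orthoH[symmetric] by (simp add: ortho_def)
    moreover have "h - k \<in> H" using a op closed_subspaceD(5)[OF H] by (auto simp: operator_in_def)
    ultimately show ?thesis using orthoD(1) cinner_self_eq_0 right_minus_eq by metis
  qed

  obtain G Gs where component: "is_adj G Gs" "\<And>x. G x \<in> ortho H" "\<And>y. Gs y \<in> op0 S"
      "\<forall>(f, h)\<in>S. (f, h) = (f, proj H h) + (0, \<i> *\<^sub>C G (f, proj H h))"
  proof -
    have "closed {(f, proj H h) | f h. (f, h) \<in> S}"
      using S(4) by (simp only: regular_def S0)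
    from ex_orthogonal_component[OF S(1,3) this H DH, folded S0] show thesis
      using that by blast
  qed

  obtain D :: "'a set" where D: "countable D" "closure D = UNIV" using separable by blast
  \<comment> \<open>The copies inside the complement of \<open>H\<close> are copies of the product,
    so the complete sequence is needed there.\<close>
  have "countable (D \<times> D)" "closure (D \<times> D) = UNIV"
    using D by (simp_all add: closure_Times)
  then obtain d :: "nat \<Rightarrow> 'a \<times> 'a" where d: "suborthonormal d" "\<And>x. transport d d x = x"
    using ex_complete_suborthonormal by blast
  have "complex_hilbert.subspace (ortho H)"
    using closed_subspace_ortho by (auto simp: closed_subspace_def)
  then obtain e where e: "suborthonormal e" "\<And>m. e m \<in> ortho H" "\<And>m. norm (e m) = 1"
    using ex_orthonormal_sequence codim unfolding orthoH by metis
  obtain U0 U1 U2 :: "'a \<times> 'a \<Rightarrow> 'a" and U0s U1s U2s V Vs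
    where chain: "chain_isometries (ortho H) U0 U1 U2 U0s U1s U2s V Vs"
    using ex_chain_isometries[OF d e] by blast

  interpret coupling H U0 U1 U2 U0s U1s U2s V Vs A B G Gs
  proof (intro coupling.intro chain coupling_axioms.intro H cs dual component)
    show "A \<subseteq> H \<times> H" "B \<subseteq> H \<times> H" using op by (auto simp: operator_in_def)
    show "0 \<le> Re (cinner (J a) a)" if "a \<in> A" for a
      using that diss(1) by (simp add: dissipative_eq)
    show "Re (cinner (J b) b) \<le> 0" if "b \<in> B" for b
    proof (cases b)
      case (Pair g k)
      hence "(g, - k) \<in> neg_op B" using that by (auto simp: neg_op_def)
      hence "0 \<le> Im (cinner (- k) g)" using diss(2) unfolding dissipative_def by blast
      thus ?thesis using Pair by (simp add: cinner_J_self cinner_minus)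
    qed
    show "a \<in> B" if a: "a \<in> A" "cinner (J a) a = 0" for a
    proof (cases a)
      case (Pair f h)
      hence "Im (cinner h f) = 0" using a by (simp add: cinner_J_self)
      \<comment> \<open>The domain equality only puts \<open>f\<close> into the domain of
        \<open>B\<close>; \<open>agree\<close> identifies the values.\<close>
      hence "f \<in> Domain A \<inter> Domain B" unfolding dom_A using a Pair by blast
      thus ?thesis using agree a Pair by blast
    qed
    show "b \<in> A" if b: "b \<in> B" "cinner (J b) b = 0" for b
    proof (cases b)
      case (Pair f h)
      hence "Im (cinner h f) = 0" using b by (simp add: cinner_J_self)
      hence "f \<in> Domain A \<inter> Domain B" unfolding dom_B using b Pair by blast
      thus ?thesis using agree b Pair by blast
    qed
    show "Gs y \<in> A \<inter> B" for y using component(3) closed_ext by blast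
  qed
  have "S \<subseteq> W 1 kappa_plus"
  proof
    fix t assume t: "t \<in> S"
    obtain f h where fh: "t = (f, h)" by (cases t)
    have "(f, proj H h) \<in> A \<inter> B" using t fh closed_ext by (auto simp: S0)
    hence "(f, proj H h) + (0, \<i> *\<^sub>C G (f, proj H h)) \<in> W 1 kappa_plus" by (rule lift_L)
    moreover have "t = (f, proj H h) + (0, \<i> *\<^sub>C G (f, proj H h))"
      using component(4) t unfolding fh by blast
    ultimately show "t \<in> W 1 kappa_plus" by (simp only:)
  qed
  moreover have "maximal_dissipative (W 1 kappa_plus)"
    using op by (intro maximal_dissipative_W) (simp add: operator_in_def)
  moreover have "compression H (W 1 kappa_plus) = A" by (rule compression_W) simp
  moreover have "compression H (adj (W 1 kappa_plus)) = B" unfolding adj_W by (rule compression_W) simp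
  ultimately show ?thesis by (intro exI[of _ "W 1 kappa_plus"] conjI) (simp_all only: H_def)
qed

end
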